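(* A class $\mathcal C$ of symmetric $0,1$-matrices has bounded stretch-width (i.e., there is a constant bounding $\mathrm{stw}(M)$ for all $M\in\mathcal C$) if and only if there is an integer $k$ such that no matrix of $\mathcal C$ has a $k$-wide division.
   Context: Let $M$ be a symmetric $n\times n$ $0,1$-matrix with rows $r_1,\dots,r_n$ and columns $c_1,\dots,c_n$. A symmetric partition of $M$ is a pair $(\mathcal R,\mathcal C)$ with $\mathcal R$ a partition of the rows and $\mathcal C$ a partition of the columns such that $r_i,r_j$ lie in the same part iff $c_i,c_j$ lie in the same part; each row part $R$ then has a symmetric column part (the columns with the same indices), and vice versa. For a row part $R$ and column part $C$, the zone $R\cap C$ is the submatrix with rows $R$ and columns $C$; it is non-constant if it contains two distinct entries. A symmetric partition sequence of $M$ is a sequence $(\mathcal R_n,\mathcal C_n),\dots,(\mathcal R_1,\mathcal C_1)$ of symmetric partitions, where the first is the partition into singletons, the last has one row part and one column part, and each is obtained from the previous one by merging two row parts and the two symmetric column parts. For a set $X$ of columns (or rows), its span $\langle X\rangle$ is the set of columns (rows) with index between the minimum and maximum index in $X$; two sets conflict if their spans intersect. The stretch value of a row part $R$ of $(\mathcal R,\mathcal C)$ is the number of column parts conflicting with the union of all column parts $C$ such that $C$ is the symmetric of $R$ or $R\cap C$ is non-constant; the stretch value of a column part is defined symmetrically; the stretch value of $(\mathcal R,\mathcal C)$ is the maximum stretch value of its parts. The stretch-width $\mathrm{stw}(M)$ is the minimum over all symmetric partition sequences of $M$ of the maximum stretch value of a partition in the sequence. A (symmetric) division is a symmetric partition all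 of whose parts consist of consecutive rows (resp. columns); write it as $(R_1,\dots,R_p)$, $(C_1,\dots,C_p)$ in order, $C_i$ being symmetric to $R_i$. A row part $R_i$ is $k$-wide if for every $k$ consecutive column parts $C_j,\dots,C_{j+k-1}$ with $j\le i\le j+k-1$, the submatrix with row set $R_i$ and column set all columns outside $C_j\cup\dots\cup C_{j+k-1}$ contains at least $k$ distinct rows; $k$-wideness of column parts is defined symmetrically. A division is $k$-wide if all its row and column parts are $k$-wide.
   Formalization: In the definition of k-wide, the k consecutive parts may run past the ends of the division (missing parts count as empty); otherwise every division with fewer than k parts would be vacuously k-wide and the claim false. Matrices have n ≥ 1. *)

theory Defs
  imports
    "HOL-Library.Disjoint_Sets"
    "Jordan_Normal_Form.Matrix"
    "Jordan_Normal_Form.DL_Submatrix"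
begin

definition symmetric_01_mat :: "int mat \<Rightarrow> bool" where
  "symmetric_01_mat M \<longleftrightarrow>
     0 < dim_row M \<and> square_mat M \<and> transpose_mat M = M \<and> elements_mat M \<subseteq> {0, 1}"

text \<open>
  Rows and columns of a matrix of dimension n are represented by their indices in {0..<n},
  so a row part and the column part symmetric to it are the same set of indices.
\<close>

type_synonym part = "nat set"

definition symmetric_partition :: "int mat \<Rightarrow> part set \<times> part set \<Rightarrow> bool" where
  "symmetric_partition M = (\<lambda>(\<R>, \<C>).
     partition_on {0..<dim_row M} \<R> \<and> partition_on {0..<dim_col M} \<C> \<and>
     (\<forall>i<dim_row M. \<forall>j<dim_row M.
        (\<exists>R\<in>\<R>. i \<in> R \<and> j \<in> R) \<longleftrightarrow> (\<exists>C\<in>\<C>. i \<in> C \<and> j \<in> C)))"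

definition non_constant :: "int mat \<Rightarrow> bool" where
  "non_constant Z \<longleftrightarrow> (\<exists>a\<in>elements_mat Z. \<exists>b\<in>elements_mat Z. a \<noteq> b)"

text \<open>The parts A and B below serve both as row parts and as their symmetric column parts.\<close>

definition merges_to :: "part set \<times> part set \<Rightarrow> part set \<times> part set \<Rightarrow> bool" where
  "merges_to = (\<lambda>(\<R>, \<C>) (\<R>', \<C>').
     \<exists>A B. A \<noteq> B \<and> A \<in> \<R> \<and> B \<in> \<R> \<and> A \<in> \<C> \<and> B \<in> \<C> \<and>
       \<R>' = insert (A \<union> B) (\<R> - {A, B}) \<and> \<C>' = insert (A \<union> B) (\<C> - {A, B}))"

text \<open>A sequence is indexed from n down to 1; values at other indices are irrelevant.\<close>

definition symmetric_partition_sequence ::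
    "int mat \<Rightarrow> (nat \<Rightarrow> part set \<times> part set) \<Rightarrow> bool" where
  "symmetric_partition_sequence M P \<longleftrightarrow>
     (let n = dim_row M in
       (\<forall>t\<in>{1..n}. symmetric_partition M (P t)) \<and>
       P n = ((\<lambda>i. {i}) ` {0..<n}, (\<lambda>i. {i}) ` {0..<n}) \<and>
       card (fst (P 1)) = 1 \<and> card (snd (P 1)) = 1 \<and>
       (\<forall>t\<in>{1..<n}. merges_to (P (Suc t)) (P t)))"

text \<open>Only used for nonempty finite sets.\<close>

definition index_span :: "nat set \<Rightarrow> nat set" where
  "index_span X = {Min X..Max X}"

definition conflict :: "nat set \<Rightarrow> nat set \<Rightarrow> bool" where
  "conflict X Y \<longleftrightarrow> index_span X \<inter> index_span Y \<noteq> {}"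

definition row_stretch :: "int mat \<Rightarrow> part set \<times> part set \<Rightarrow> part \<Rightarrow> nat" where
  "row_stretch M = (\<lambda>(\<R>, \<C>) R.
     card {D\<in>\<C>. conflict D (\<Union>{C\<in>\<C>. C = R \<or> non_constant (submatrix M R C)})})"

definition col_stretch :: "int mat \<Rightarrow> part set \<times> part set \<Rightarrow> part \<Rightarrow> nat" where
  "col_stretch M = (\<lambda>(\<R>, \<C>) C.
     card {D\<in>\<R>. conflict D (\<Union>{R\<in>\<R>. R = C \<or> non_constant (submatrix M R C)})})"

definition stretch_value :: "int mat \<Rightarrow> part set \<times> part set \<Rightarrow> nat" where
  "stretch_value M = (\<lambda>(\<R>, \<C>).
     Max (row_stretch M (\<R>, \<C>) ` \<R> \<union> col_stretch M (\<R>, \<C>) ` \<C>))"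

definition stretch_width :: "int mat \<Rightarrow> nat" where
  "stretch_width M =
     (INF P\<in>{P. symmetric_partition_sequence M P}.
        Max ((\<lambda>t. stretch_value M (P t)) ` {1..dim_row M}))"

definition consecutive :: "nat set \<Rightarrow> bool" where
  "consecutive X \<longleftrightarrow> (\<exists>a b. X = {a..<b})"

text \<open>
  A division is given by the lists of its row parts and of its column parts, in order.
  Since both lists are ordered, entry i of one is symmetric to entry i of the other.
\<close>

definition division :: "int mat \<Rightarrow> part list \<Rightarrow> part list \<Rightarrow> bool" where
  "division M Rs Cs \<longleftrightarrow>
     symmetric_partition M (set Rs, set Cs) \<and>
     (\<forall>X\<in>set Rs \<union> set Cs. consecutive X) \<and>
     sorted_wrt (\<lambda>X Y. \<forall>x\<in>X. \<forall>y\<in>Y. x < y) Rs \<and>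
     sorted_wrt (\<lambda>X Y. \<forall>x\<in>X. \<forall>y\<in>Y. x < y) Cs"

text \<open>
  The union of the k consecutive parts of indices j, ..., j+k-1. The index j ranges over the
  integers: indices that do not belong to a part contribute nothing, so a window may stick out
  of the division at either end. If instead windows were required to fit inside the division,
  then every division with fewer than k parts would be vacuously k-wide.
\<close>

definition window :: "nat \<Rightarrow> part list \<Rightarrow> int \<Rightarrow> nat set" where
  "window k Xs j = \<Union>{Xs ! l | l. l < length Xs \<and> j \<le> int l \<and> int l \<le> j + int k - 1}"

text \<open>If there are no columns outside the window, the submatrix has a single, empty, distinct row.\<close>

definition wide_row_part :: "nat \<Rightarrow> int mat \<Rightarrow> part list \<Rightarrow> part list \<Rightarrow> nat \<Rightarrow> bool" where
  "wide_row_part k M Rs Cs i \<longleftrightarrow>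
     (\<forall>j::int. j \<le> int i \<and> int i \<le> j + int k - 1 \<longrightarrow>
        k \<le> card (set (rows (submatrix M (Rs ! i) ({0..<dim_col M} - window k Cs j)))))"

definition wide_col_part :: "nat \<Rightarrow> int mat \<Rightarrow> part list \<Rightarrow> part list \<Rightarrow> nat \<Rightarrow> bool" where
  "wide_col_part k M Rs Cs i \<longleftrightarrow>
     (\<forall>j::int. j \<le> int i \<and> int i \<le> j + int k - 1 \<longrightarrow>
        k \<le> card (set (cols (submatrix M ({0..<dim_row M} - window k Rs j) (Cs ! i)))))"

definition wide_division :: "nat \<Rightarrow> int mat \<Rightarrow> part list \<Rightarrow> part list \<Rightarrow> bool" where
  "wide_division k M Rs Cs \<longleftrightarrow>
     division M Rs Cs \<and>
     (\<forall>i<length Rs. wide_row_part k M Rs Cs i) \<and>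
     (\<forall>i<length Cs. wide_col_part k M Rs Cs i)"

end

theory Submission
  imports Defs
begin

text \<open>
  Suppose a partition sequence of stretch value at most c is given, and consider the first partition
  in it that has a part whose span contains a block of a given division. Its parts near that block
  are still short, so the block is covered by at most c parts all of whose non-constant zones lie in
  a short window: the division is not wide.

  Conversely, start from the division into singletons and merge neighbouring blocks greedily, as long
  as each block has fewer than k distinct rows outside the columns of the 4k+1 blocks around it. If
  this gets stuck, merging the blocks in pairs yields a k-wide division. Otherwise, splitting each
  block into its classes of equal rows yields partitions each refining the next, and any partition
  sequence through them has small stretch value.
\<close>

section \<open>Submatrices\<close>

text \<open>The stretch value counts parts, whereas wideness speaks of windows of blocks. A count of
  conflicting parts bounds a distance only while every part meets few blocks, so the moment just
  before a span swallows a block is decisive: a set whose span contains no block meets at most two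
  blocks, and one merge at most doubles this. With \<open>4\<close> blocks per part and
  \<open>c\<close> conflicting parts, the relevant columns stay within \<open>4 * c\<close> blocks
  on either side, whence \<open>8 * c + 2\<close>. In the converse direction, wideness quantifies
  over all windows of \<open>k\<close> blocks around a block, while the classes need a single region
  of ignored columns. A window of \<open>k\<close> pairs containing a given pair reaches at most
  \<open>k - 1\<close> pairs to either side, which is within \<open>2 * k\<close> of the unpaired
  blocks. So the radius \<open>2 * k\<close> lets one count of classes deal with all the windows at
  once. The final bound \<open>(4 * k + 1) * (2 * k)\<close> is the number of blocks within that
  radius times a bound on the parts in a block midway through a merge.\<close>

lemma pick_image:
  assumes "finite I"
  shows "pick I ` {0..<card I} = I"
proof
  show "pick I ` {0..<card I} \<subseteq> I"
    using pick_in_set by auto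
  show "I \<subseteq> pick I ` {0..<card I}"
  proof
    fix x assume "x \<in> I"
    then have "{a \<in> I. a < x} \<subset> I" by auto
    then have "card {a \<in> I. a < x} < card I"
      by (rule psubset_card_mono[OF assms])
    then show "x \<in> pick I ` {0..<card I}"
      using pick_card_in_set[OF \<open>x \<in> I\<close>] by (intro image_eqI[of _ _ "card {a \<in> I. a < x}"]) simp_all
  qed
qed

context
  fixes M :: "'a mat" and I J :: "nat set"
  assumes I: "I \<subseteq> {0..<dim_row M}" and J: "J \<subseteq> {0..<dim_col M}"
begin

lemma submatrix_alt:
  "submatrix M I J = mat (card I) (card J) (\<lambda>(i, j). M $$ (pick I i, pick J j))"
proof -
  have "{i. i < dim_row M \<and> i \<in> I} = I" "{j. j < dim_col M \<and> j \<in> J} = J"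
    using I J by auto
  then show ?thesis by (simp add: submatrix_def)
qed

lemma elements_submatrix:
  "elements_mat (submatrix M I J) = {M $$ (x, y) | x y. x \<in> I \<and> y \<in> J}"
proof -
  have fin: "finite I" "finite J" using I J finite_subset by blast+
  have "elements_mat (submatrix M I J)
      = {M $$ (pick I i, pick J j) | i j. i \<in> {0..<card I} \<and> j \<in> {0..<card J}}"
    unfolding submatrix_alt elements_mat_def by fastforce
  also have "\<dots> = {M $$ (x, y) | x y. x \<in> pick I ` {0..<card I} \<and> y \<in> pick J ` {0..<card J}}"
    by blast
  finally show ?thesis by (simp only: pick_image[OF fin(1)] pick_image[OF fin(2)])
qed

text \<open>With \<open>restrict\<close>, two rows are equal as functions exactly when they agree on
  \<open>J\<close>, so distinct rows can be counted without the enumeration \<open>pick\<close>. For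
  \<open>J = {}\<close> all rows coincide, on both sides of the equation.\<close>

lemma card_rows_submatrix:
  "card (set (rows (submatrix M I J))) = card ((\<lambda>x. restrict (\<lambda>y. M $$ (x, y)) J) ` I)"
proof -
  have fin: "finite I" "finite J" using I J finite_subset by blast+
  let ?g = "\<lambda>h. vec (card J) (\<lambda>j. h (pick J j))"
  let ?R = "\<lambda>x. restrict (\<lambda>y. M $$ (x, y)) J"
  have "set (rows (submatrix M I J)) = (\<lambda>i. row (submatrix M I J) i) ` {0..<card I}"
    by (simp add: rows_def submatrix_alt)
  also have "\<dots> = (\<lambda>i. ?g (?R (pick I i))) ` {0..<card I}"
  proof (rule image_cong[OF refl])
    fix i assume "i \<in> {0..<card I}"
    then show "row (submatrix M I J) i = ?g (?R (pick I i))"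
      using pick_image[OF fin(2)] by (intro eq_vecI) (auto simp: submatrix_alt)
  qed
  also have "\<dots> = ?g ` ?R ` pick I ` {0..<card I}" by (simp add: image_image)
  also have "\<dots> = ?g ` ?R ` I" by (simp only: pick_image[OF fin(1)])
  finally have eq: "set (rows (submatrix M I J)) = ?g ` ?R ` I" .
  have "inj_on ?g (?R ` I)"
  proof (rule inj_onI)
    fix h h' assume h: "h \<in> ?R ` I" "h' \<in> ?R ` I" "?g h = ?g h'"
    show "h = h'"
    proof
      fix y
      show "h y = h' y"
      proof (cases "y \<in> J")
        case True
        then obtain j where "j < card J" "y = pick J j"
          using pick_image[OF fin(2)] by fastforce
        then show ?thesis using arg_cong[OF h(3), of "\<lambda>v. v $ j"] by simp
      next
        case False
        then show ?thesis using h(1,2) by auto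
      qed
    qed
  qed
  then show ?thesis unfolding eq by (rule card_image)
qed

end

lemma non_constant_submatrix:
  assumes "I \<subseteq> {0..<dim_row M}" "J \<subseteq> {0..<dim_col M}"
  shows "non_constant (submatrix M I J) \<longleftrightarrow>
    (\<exists>x\<in>I. \<exists>y\<in>J. \<exists>x'\<in>I. \<exists>y'\<in>J. M $$ (x, y) \<noteq> M $$ (x', y'))"
  unfolding non_constant_def elements_submatrix[OF assms] by blast

lemma symmetric_entry:
  assumes "symmetric_01_mat M" "x < dim_row M" "y < dim_row M"
  shows "M $$ (x, y) = M $$ (y, x)"
proof -
  have "M $$ (x, y) = transpose_mat M $$ (x, y)" using assms(1) by (simp add: symmetric_01_mat_def)
  also have "\<dots> = M $$ (y, x)"
    using assms by (intro index_transpose_mat) (simp_all add: symmetric_01_mat_def)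
  finally show ?thesis .
qed

lemma dim_col_symmetric: "symmetric_01_mat M \<Longrightarrow> dim_col M = dim_row M"
  by (simp add: symmetric_01_mat_def)

lemma transpose_submatrix:
  assumes M: "symmetric_01_mat M" and I: "I \<subseteq> {0..<dim_row M}" and J: "J \<subseteq> {0..<dim_row M}"
  shows "transpose_mat (submatrix M I J) = submatrix M J I"
proof -
  have d: "dim_col M = dim_row M" by (rule dim_col_symmetric[OF M])
  have fin: "finite I" "finite J" using I J finite_subset by blast+
  have pI: "\<And>i. i < card I \<Longrightarrow> pick I i < dim_row M" and pJ: "\<And>i. i < card J \<Longrightarrow> pick J i < dim_row M"
    using pick_in_set I J by (metis atLeastLessThan_iff subsetD)+
  have 1: "submatrix M I J = mat (card I) (card J) (\<lambda>(i, j). M $$ (pick I i, pick J j))"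
    using I J d by (intro submatrix_alt) auto
  have 2: "submatrix M J I = mat (card J) (card I) (\<lambda>(i, j). M $$ (pick J i, pick I j))"
    using I J d by (intro submatrix_alt) auto
  show ?thesis unfolding 1 2
    by (rule eq_matI) (auto simp: symmetric_entry[OF M pI pJ])
qed

lemma non_constant_submatrix_commute:
  assumes "symmetric_01_mat M" "I \<subseteq> {0..<dim_row M}" "J \<subseteq> {0..<dim_row M}"
  shows "non_constant (submatrix M I J) = non_constant (submatrix M J I)"
proof -
  have c: "I \<subseteq> {0..<dim_col M}" "J \<subseteq> {0..<dim_col M}"
    using assms by (simp_all add: dim_col_symmetric)
  have eq: "M $$ (x, y) = M $$ (y, x)" if "x \<in> I" "y \<in> J" for x y
    using that assms by (intro symmetric_entry) auto
  show ?thesis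
    unfolding non_constant_submatrix[OF assms(2) c(2)] non_constant_submatrix[OF assms(3) c(1)]
    using eq by metis
qed

section \<open>Symmetric partitions and merge sequences\<close>

lemma partition_on_part_eq:
  assumes "partition_on A Q" "X \<in> Q" "Y \<in> Q" "x \<in> X" "x \<in> Y"
  shows "X = Y"
  using partition_onD2[OF assms(1)] assms(2-) by (auto simp: disjoint_def)

lemma partition_on_part_alt:
  assumes "partition_on A Q" "X \<in> Q" "x \<in> X"
  shows "X = {y \<in> A. \<exists>Y\<in>Q. x \<in> Y \<and> y \<in> Y}"
proof (intro subset_antisym subsetI)
  fix y assume "y \<in> X"
  then show "y \<in> {y \<in> A. \<exists>Y\<in>Q. x \<in> Y \<and> y \<in> Y}"
    using assms partition_onD1[OF assms(1)] by auto
next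
  fix y assume "y \<in> {y \<in> A. \<exists>Y\<in>Q. x \<in> Y \<and> y \<in> Y}"
  then obtain Y where "Y \<in> Q" "x \<in> Y" "y \<in> Y" by blast
  then show "y \<in> X" using partition_on_part_eq[OF assms(1,2) _ assms(3)] by simp
qed

lemma partition_on_subsetI:
  assumes Q: "partition_on A Q" and Q': "partition_on A Q'"
    and eq: "\<And>i j. i \<in> A \<Longrightarrow> j \<in> A \<Longrightarrow> (\<exists>X\<in>Q. i \<in> X \<and> j \<in> X) = (\<exists>X\<in>Q'. i \<in> X \<and> j \<in> X)"
  shows "Q \<subseteq> Q'"
proof
  fix X assume X: "X \<in> Q"
  then obtain x where x: "x \<in> X" using partition_onD3[OF Q] by (metis ex_in_conv)
  have xA: "x \<in> A" using X x partition_onD1[OF Q] by auto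
  then obtain Y where Y: "Y \<in> Q'" "x \<in> Y" using partition_onD1[OF Q'] by auto
  have "X = {y \<in> A. \<exists>Y\<in>Q. x \<in> Y \<and> y \<in> Y}" by (rule partition_on_part_alt[OF Q X x])
  also have "\<dots> = {y \<in> A. \<exists>Y\<in>Q'. x \<in> Y \<and> y \<in> Y}"
    by (rule Collect_cong) (use eq[OF xA] in blast)
  also have "\<dots> = Y" by (rule partition_on_part_alt[OF Q' Y, symmetric])
  finally show "X \<in> Q'" using Y by simp
qed

text \<open>A partition is determined by its same-part relation, and rows and columns share their
  index set. Hence one partition of the indices carries all the information from here on.\<close>

lemma symmetric_partition_iff:
  assumes "dim_col M = dim_row M"
  shows "symmetric_partition M (R, C) \<longleftrightarrow> R = C \<and> partition_on {0..<dim_row M} R"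
proof
  let ?A = "{0..<dim_row M}"
  assume "symmetric_partition M (R, C)"
  then have p: "partition_on ?A R" "partition_on ?A C"
    and eq: "\<forall>i<dim_row M. \<forall>j<dim_row M.
      (\<exists>X\<in>R. i \<in> X \<and> j \<in> X) \<longleftrightarrow> (\<exists>X\<in>C. i \<in> X \<and> j \<in> X)"
    using assms unfolding symmetric_partition_def by simp_all
  have "R \<subseteq> C" by (rule partition_on_subsetI[OF p]) (use eq in simp)
  moreover have "C \<subseteq> R" by (rule partition_on_subsetI[OF p(2,1)]) (use eq in simp)
  ultimately show "R = C \<and> partition_on ?A R" using p by simp
next
  assume "R = C \<and> partition_on {0..<dim_row M} R"
  then show "symmetric_partition M (R, C)" using assms by (auto simp: symmetric_partition_def)
qed

text \<open>The zones inspected on the two sides are transposes of each other, and transposing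
  preserves non-constancy.\<close>

lemma col_stretch_eq_row_stretch:
  assumes M: "symmetric_01_mat M" and Q: "partition_on {0..<dim_row M} Q" and X: "X \<in> Q"
  shows "col_stretch M (Q, Q) X = row_stretch M (Q, Q) X"
proof -
  have sub: "Y \<subseteq> {0..<dim_row M}" if "Y \<in> Q" for Y using that partition_onD1[OF Q] by auto
  have "{C \<in> Q. C = X \<or> non_constant (submatrix M C X)}
      = {C \<in> Q. C = X \<or> non_constant (submatrix M X C)}"
    using non_constant_submatrix_commute[OF M sub sub[OF X]] by auto
  then show ?thesis by (simp add: col_stretch_def row_stretch_def)
qed

lemma stretch_value_le_iff:
  assumes M: "symmetric_01_mat M" and Q: "partition_on {0..<dim_row M} Q"
  shows "stretch_value M (Q, Q) \<le> c \<longleftrightarrow> (\<forall>X\<in>Q. row_stretch M (Q, Q) X \<le> c)"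
proof -
  have "finite Q" using Q by (rule finite_elements[rotated]) simp
  moreover have "Q \<noteq> {}" using partition_onD1[OF Q] M by (auto simp: symmetric_01_mat_def)
  ultimately show ?thesis using col_stretch_eq_row_stretch[OF M Q]
    by (simp add: stretch_value_def ball_Un)
qed

section \<open>Merging from a partition to a coarser one\<close>

definition merge_step :: "('a set set \<Rightarrow> bool) \<Rightarrow> 'a set set \<Rightarrow> 'a set set \<Rightarrow> bool" where
  "merge_step G Q Q' \<longleftrightarrow>
     (\<exists>A\<in>Q. \<exists>B\<in>Q. A \<noteq> B \<and> Q' = insert (A \<union> B) (Q - {A, B})) \<and> G Q'"

lemma partition_on_merge:
  assumes Q: "partition_on S Q" and AB: "A \<in> Q" "B \<in> Q" "A \<noteq> B" and "finite S"
  shows "partition_on S (insert (A \<union> B) (Q - {A, B}))"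
    and "Suc (card (insert (A \<union> B) (Q - {A, B}))) = card Q"
proof -
  have fin: "finite Q" by (rule finite_elements[OF \<open>finite S\<close> Q])
  have dj: "X \<inter> Y = {}" if "X \<in> Q" "Y \<in> Q" "X \<noteq> Y" for X Y
    using partition_onD2[OF Q] that by (auto simp: disjoint_def)
  have ne: "X \<noteq> {}" if "X \<in> Q" for X using that partition_onD3[OF Q] by auto
  let ?P = "Q - {A, B}"
  have disj: "(A \<union> B) \<inter> X = {}" if "X \<in> ?P" for X
    using that dj[of A X] dj[of B X] AB by auto
  show "partition_on S (insert (A \<union> B) ?P)"
  proof (rule partition_onI)
    show "\<Union> (insert (A \<union> B) ?P) = S" using partition_onD1[OF Q] AB by auto
    show "{} \<notin> insert (A \<union> B) ?P" using ne ne[OF AB(1)] by auto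
  next
    fix p q assume "p \<in> insert (A \<union> B) ?P" "q \<in> insert (A \<union> B) ?P" "p \<noteq> q"
    then show "disjnt p q" unfolding disjnt_def
      using disj[of p] disj[of q] dj[of p q] by (elim insertE) auto
  qed
  have "A \<union> B \<notin> ?P" using disj[of "A \<union> B"] ne[OF AB(1)] by auto
  moreover have "card {A, B} \<le> card Q" using fin AB by (intro card_mono) auto
  moreover have "card ?P = card Q - card {A, B}" using AB by (intro card_Diff_subset) auto
  ultimately show "Suc (card (insert (A \<union> B) ?P)) = card Q"
    using fin AB(3) by simp
qed

text \<open>As long as two parts of \<open>Q\<close> lie in one part of \<open>Q'\<close>, merging
  them stays between \<open>Q\<close> and \<open>Q'\<close>; when no such pair is left, the two
  partitions are equal. So \<open>G\<close> has to be checked only for partitions in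
  between.\<close>

lemma merge_steps_refines:
  assumes "refines S Q Q'" "finite S"
    and "\<And>P. refines S Q P \<Longrightarrow> refines S P Q' \<Longrightarrow> G P"
  shows "(merge_step G)\<^sup>*\<^sup>* Q Q'"
  using assms(1,3)
proof (induction "card Q" arbitrary: Q rule: less_induct)
  case less
  have Q: "partition_on S Q" and Q': "partition_on S Q'" and sub: "\<forall>X\<in>Q. \<exists>Y\<in>Q'. X \<subseteq> Y"
    using less.prems(1) by (auto simp: refines_def)
  show ?case
  proof (cases "\<exists>A\<in>Q. \<exists>B\<in>Q. \<exists>Y\<in>Q'. A \<noteq> B \<and> A \<subseteq> Y \<and> B \<subseteq> Y")
    case True
    then obtain A B Y where AB: "A \<in> Q" "B \<in> Q" "A \<noteq> B" and Y: "Y \<in> Q'" "A \<subseteq> Y" "B \<subseteq> Y" by blast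
    define P where "P = insert (A \<union> B) (Q - {A, B})"
    have P: "partition_on S P" "Suc (card P) = card Q"
      unfolding P_def using partition_on_merge[OF Q AB assms(2)] by blast+
    have "\<forall>X\<in>P. \<exists>Y\<in>Q'. X \<subseteq> Y" unfolding P_def using sub Y by blast
    then have PQ': "refines S P Q'" using P Q' by (auto simp: refines_def)
    have "\<exists>Y\<in>P. X \<subseteq> Y" if "X \<in> Q" for X
      using that by (cases "X \<in> {A, B}") (auto simp: P_def)
    then have QP: "refines S Q P" using P Q by (auto simp: refines_def)
    have "merge_step G Q P" unfolding merge_step_def
      using AB P_def less.prems(2)[OF QP PQ'] by blast
    moreover have "(merge_step G)\<^sup>*\<^sup>* P Q'"
      using P(2) PQ' less.prems(2) refines_trans[OF QP] by (intro less.hyps) auto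
    ultimately show ?thesis by (rule converse_rtranclp_into_rtranclp)
  next
    case False
    have "Y \<subseteq> X" if XY: "X \<in> Q" "Y \<in> Q'" "X \<subseteq> Y" for X Y
    proof
      fix y assume y: "y \<in> Y"
      then obtain Z where Z: "Z \<in> Q" "y \<in> Z"
        using XY(2) partition_onD1[OF Q] partition_onD1[OF Q'] by blast
      then obtain Y' where "Y' \<in> Q'" "Z \<subseteq> Y'" using sub by blast
      then have "Z \<subseteq> Y" using partition_on_part_eq[OF Q' _ XY(2)] Z(2) y by blast
      then show "y \<in> X" using False Z XY by blast
    qed
    then have "Q \<subseteq> Q'" using sub by (metis subset_antisym subsetI)
    moreover have "Q' \<subseteq> Q"
    proof
      fix Y assume Y: "Y \<in> Q'"
      then obtain y where y: "y \<in> Y" using partition_onD3[OF Q'] by (metis ex_in_conv)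
      then obtain X where "X \<in> Q" "y \<in> X" using Y partition_onD1[OF Q] partition_onD1[OF Q'] by blast
      then show "Y \<in> Q" using \<open>Q \<subseteq> Q'\<close> partition_on_part_eq[OF Q' Y] y by blast
    qed
    ultimately show ?thesis by simp
  qed
qed

text \<open>Each merge lowers the number of parts by one, so indexing every partition by its
  cardinality yields the downward numbering of \<open>symmetric_partition_sequence\<close>.\<close>

lemma merge_steps_sequence:
  assumes "(merge_step G)\<^sup>*\<^sup>* Q0 Q" "partition_on S Q0" "finite S" "G Q0"
  shows "partition_on S Q \<and> card Q \<le> card Q0 \<and> (\<exists>f. f (card Q0) = Q0 \<and> f (card Q) = Q \<and>
     (\<forall>t\<in>{card Q..card Q0}. partition_on S (f t) \<and> G (f t)) \<and>
     (\<forall>t\<in>{card Q..<card Q0}. merge_step G (f (Suc t)) (f t)))"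
  using assms(1)
proof (induction rule: rtranclp_induct)
  case base
  then show ?case using assms(2,4) by (intro conjI exI[of _ "\<lambda>_. Q0"]) auto
next
  case (step Q Q')
  from step.IH obtain f where Q: "partition_on S Q" "card Q \<le> card Q0"
    and f: "f (card Q0) = Q0" "f (card Q) = Q"
      "\<And>t. t \<in> {card Q..card Q0} \<Longrightarrow> partition_on S (f t) \<and> G (f t)"
      "\<And>t. t \<in> {card Q..<card Q0} \<Longrightarrow> merge_step G (f (Suc t)) (f t)" by blast
  obtain A B where AB: "A \<in> Q" "B \<in> Q" "A \<noteq> B" and Q': "Q' = insert (A \<union> B) (Q - {A, B})" and G: "G Q'"
    using step.hyps(2) by (auto simp: merge_step_def)
  have p: "partition_on S Q'" and c: "Suc (card Q') = card Q"
    using partition_on_merge[OF Q(1) AB assms(3)] Q' by auto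
  define g where "g = f(card Q' := Q')"
  have "partition_on S (g t) \<and> G (g t)" if "t \<in> {card Q'..card Q0}" for t
    using that f(3)[of t] c p G by (cases "t = card Q'") (auto simp: g_def)
  moreover have "merge_step G (g (Suc t)) (g t)" if "t \<in> {card Q'..<card Q0}" for t
    using that f(4)[of t] f(2) c step.hyps(2) by (cases "t = card Q'") (auto simp: g_def)
  moreover have "g (card Q0) = Q0" "g (card Q') = Q'" using f c Q(2) by (auto simp: g_def)
  ultimately show ?case using p c Q(2) by (intro conjI exI[of _ g] ballI) auto
qed

abbreviation singletons :: "nat \<Rightarrow> part set" where
  "singletons n \<equiv> (\<lambda>i. {i}) ` {0..<n}"

lemma card_singletons: "card (singletons n) = n"
  by (subst card_image) (auto simp: inj_on_def)

lemma exists_symmetric_partition_sequence: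
  assumes M: "symmetric_01_mat M"
    and steps: "(merge_step G)\<^sup>*\<^sup>* (singletons (dim_row M)) {{0..<dim_row M}}"
    and G: "G (singletons (dim_row M))"
  obtains P where "symmetric_partition_sequence M P"
    and "\<And>t. t \<in> {1..dim_row M} \<Longrightarrow> \<exists>Q. P t = (Q, Q) \<and> partition_on {0..<dim_row M} Q \<and> G Q"
proof -
  let ?n = "dim_row M"
  from merge_steps_sequence[OF steps partition_on_singletons finite_atLeastLessThan G]
  obtain f where f: "f ?n = singletons ?n" "f 1 = {{0..<?n}}"
      "\<And>t. t \<in> {1..?n} \<Longrightarrow> partition_on {0..<?n} (f t) \<and> G (f t)"
      "\<And>t. t \<in> {1..<?n} \<Longrightarrow> merge_step G (f (Suc t)) (f t)"
    by (auto simp: card_singletons)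
  have "merges_to (f (Suc t), f (Suc t)) (f t, f t)" if "t \<in> {1..<?n}" for t
    using f(4)[OF that] unfolding merges_to_def merge_step_def by simp blast
  moreover have "symmetric_partition M (f t, f t)" if "t \<in> {1..?n}" for t
    using f(3)[OF that] symmetric_partition_iff[OF dim_col_symmetric[OF M]] by blast
  ultimately have "symmetric_partition_sequence M (\<lambda>t. (f t, f t))"
    using f(1,2) by (auto simp: symmetric_partition_sequence_def)
  then show thesis using f(3) by (intro that[of "\<lambda>t. (f t, f t)"]) auto
qed

text \<open>An infimum of a non-empty set of natural numbers belongs to the set. What needs proof is
  that some sequence exists; any merging order will do, hence the trivial condition on the
  partitions.\<close>

lemma stretch_width_attained:
  assumes M: "symmetric_01_mat M"
  obtains P where "symmetric_partition_sequence M P"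
    and "\<And>t. t \<in> {1..dim_row M} \<Longrightarrow> stretch_value M (P t) \<le> stretch_width M"
proof -
  let ?n = "dim_row M"
  let ?F = "\<lambda>P. Max ((\<lambda>t. stretch_value M (P t)) ` {1..?n})"
  have "refines {0..<?n} (singletons ?n) {{0..<?n}}"
    using M partition_on_singletons[of "{0..<?n}"] partition_on_space[of "{0..<?n}"]
    by (auto simp: refines_def symmetric_01_mat_def)
  then have "(merge_step (\<lambda>_. True))\<^sup>*\<^sup>* (singletons ?n) {{0..<?n}}"
    by (rule merge_steps_refines) auto
  then obtain P0 where "symmetric_partition_sequence M P0"
    using exists_symmetric_partition_sequence[OF M] by blast
  then have "stretch_width M \<in> ?F ` {P. symmetric_partition_sequence M P}"
    unfolding stretch_width_def by (intro Inf_nat_def1) auto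
  then obtain P where P: "symmetric_partition_sequence M P" "stretch_width M = ?F P" by blast
  have "stretch_value M (P t) \<le> stretch_width M" if "t \<in> {1..?n}" for t
    unfolding P(2) using that by (intro Max_ge) auto
  then show thesis using that P by blast
qed

lemma stretch_width_le:
  assumes M: "symmetric_01_mat M" and P: "symmetric_partition_sequence M P"
    and le: "\<And>t. t \<in> {1..dim_row M} \<Longrightarrow> stretch_value M (P t) \<le> c"
  shows "stretch_width M \<le> c"
proof -
  have "stretch_width M \<le> Max ((\<lambda>t. stretch_value M (P t)) ` {1..dim_row M})"
    unfolding stretch_width_def using P by (intro cINF_lower) auto
  also have "\<dots> \<le> c" using le M by (subst Max_le_iff) (auto simp: symmetric_01_mat_def Suc_le_eq)
  finally show ?thesis .
qed

section \<open>Divisions as monotone functions\<close>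

text \<open>
  A division into p parts is represented by the monotone function d that maps an index to the
  number of its part.
\<close>

definition blocks :: "nat \<Rightarrow> (nat \<Rightarrow> nat) \<Rightarrow> nat \<Rightarrow> part list" where
  "blocks n d p = map (\<lambda>b. {x \<in> {0..<n}. d x = b}) [0..<p]"

lemma length_blocks [simp]: "length (blocks n d p) = p"
  by (simp add: blocks_def)

lemma nth_blocks [simp]: "b < p \<Longrightarrow> blocks n d p ! b = {x \<in> {0..<n}. d x = b}"
  by (simp add: blocks_def)

text \<open>All block numbers lie below \<open>p\<close>, so a window that sticks out at an end
  needs no clipping: membership is a condition on \<open>d\<close> alone.\<close>

lemma window_blocks:
  assumes "d ` {0..<n} \<subseteq> {0..<p}"
  shows "window k (blocks n d p) j
    = {x \<in> {0..<n}. j \<le> int (d x) \<and> int (d x) \<le> j + int k - 1}"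
proof (intro subset_antisym subsetI)
  fix x assume x: "x \<in> {x \<in> {0..<n}. j \<le> int (d x) \<and> int (d x) \<le> j + int k - 1}"
  then have "d x < p" using assms by force
  moreover from this have "x \<in> blocks n d p ! d x" using x by simp
  ultimately show "x \<in> window k (blocks n d p) j"
    unfolding window_def using x by (intro UnionI[of "blocks n d p ! d x"] CollectI exI[of _ "d x"]) auto
qed (auto simp: window_def)

lemma mono_on_less_imp_less:
  assumes "mono_on A d" "x \<in> A" "y \<in> A" "d x < (d y :: nat)"
  shows "x < (y :: nat)"
  using mono_onD[OF assms(1,3,2)] assms(4) by (meson leD leI)

lemma partition_on_blocks:
  assumes "d ` {0..<n} = {0..<p}"
  shows "partition_on {0..<n} (set (blocks n d p))"
proof (rule partition_onI)
  show "\<Union> (set (blocks n d p)) = {0..<n}" using assms by (auto simp: blocks_def)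
  show "disjnt P Q" if "P \<in> set (blocks n d p)" "Q \<in> set (blocks n d p)" "P \<noteq> Q" for P Q
    using that by (auto simp: blocks_def disjnt_iff)
  show "{} \<notin> set (blocks n d p)"
  proof
    assume "{} \<in> set (blocks n d p)"
    then obtain b where "b < p" "{} = {x \<in> {0..<n}. d x = b}" by (auto simp: blocks_def)
    moreover have "b \<in> d ` {0..<n}" using \<open>b < p\<close> assms by simp
    ultimately show False by blast
  qed
qed

lemma consecutive_block:
  fixes d :: "nat \<Rightarrow> nat"
  assumes "mono_on {0..<n} d"
  shows "consecutive {x \<in> {0..<n}. d x = b}"
proof (cases "{x \<in> {0..<n}. d x = b} = {}")
  case True
  then show ?thesis unfolding consecutive_def by (metis atLeastLessThan_empty order_refl)
next
  case False
  let ?B = "{x \<in> {0..<n}. d x = b}"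
  have fin: "finite ?B" by simp
  have mem: "Min ?B \<in> ?B" "Max ?B \<in> ?B" using Min_in[OF fin False] Max_in[OF fin False] by auto
  have "?B = {Min ?B..<Suc (Max ?B)}"
  proof (intro subset_antisym subsetI)
    fix x assume "x \<in> ?B"
    then show "x \<in> {Min ?B..<Suc (Max ?B)}" using fin Min_le Max_ge by (simp add: less_Suc_eq_le)
  next
    fix x assume x: "x \<in> {Min ?B..<Suc (Max ?B)}"
    then have xn: "x \<in> {0..<n}" using mem by auto
    have "d (Min ?B) \<le> d x" using mem x xn by (intro mono_onD[OF assms]) auto
    moreover have "d x \<le> d (Max ?B)" using mem x xn by (intro mono_onD[OF assms]) auto
    ultimately show "x \<in> ?B" using mem xn by auto
  qed
  then show ?thesis unfolding consecutive_def by blast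
qed

lemma division_blocks:
  assumes M: "symmetric_01_mat M" and mono: "mono_on {0..<dim_row M} d"
    and img: "d ` {0..<dim_row M} = {0..<p}"
  shows "division M (blocks (dim_row M) d p) (blocks (dim_row M) d p)"
proof -
  let ?B = "blocks (dim_row M) d p"
  have "symmetric_partition M (set ?B, set ?B)"
    using symmetric_partition_iff[OF dim_col_symmetric[OF M]] partition_on_blocks[OF img] by blast
  moreover have "\<forall>X\<in>set ?B. consecutive X"
    using consecutive_block[OF mono] by (auto simp: blocks_def)
  moreover have "sorted_wrt (\<lambda>X Y. \<forall>x\<in>X. \<forall>y\<in>Y. x < y) ?B"
    unfolding sorted_wrt_iff_nth_less
    using mono_on_less_imp_less[OF mono] by simp
  ultimately show ?thesis unfolding division_def by simp
qed

text \<open>Both lists are strictly increasing in \<open>Min\<close>, so their lists of minima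
  coincide; since parts are disjoint and non-empty, a minimum determines its part.\<close>

lemma sorted_partition_unique:
  assumes Q: "partition_on A (set Rs)" and "finite A" and eq: "set Cs = set Rs"
    and Rs: "sorted_wrt (\<lambda>X Y. \<forall>x\<in>X. \<forall>y\<in>Y. x < (y :: nat)) Rs"
    and Cs: "sorted_wrt (\<lambda>X Y. \<forall>x\<in>X. \<forall>y\<in>Y. x < y) Cs"
  shows "Cs = Rs"
proof -
  have Min: "Min X \<in> X" if "X \<in> set Rs" for X
  proof (rule Min_in)
    show "finite X" using that partition_onD1[OF Q] \<open>finite A\<close> by (auto intro: finite_subset)
    show "X \<noteq> {}" using that partition_onD3[OF Q] by auto
  qed
  have "sorted_wrt (<) (map Min Rs)" "sorted_wrt (<) (map Min Cs)"
    unfolding sorted_wrt_map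
    by (rule sorted_wrt_mono_rel[OF _ Rs], use Min in blast)
       (rule sorted_wrt_mono_rel[OF _ Cs], use Min eq in blast)
  then have "map Min Cs = map Min Rs" using eq by (intro strict_sorted_equal) auto
  moreover have "inj_on Min (set Cs \<union> set Rs)"
  proof (rule inj_onI)
    fix X Y assume "X \<in> set Cs \<union> set Rs" "Y \<in> set Cs \<union> set Rs" and m: "Min X = Min Y"
    then have XY: "X \<in> set Rs" "Y \<in> set Rs" using eq by auto
    show "X = Y" using partition_on_part_eq[OF Q XY Min[OF XY(1)]] Min[OF XY(2)] m by simp
  qed
  ultimately show ?thesis by (simp add: inj_on_map_eq_map)
qed

lemma division_as_blocks:
  assumes M: "symmetric_01_mat M" and div: "division M Rs Cs"
  obtains d p where "mono_on {0..<dim_row M} d" "d ` {0..<dim_row M} = {0..<p}"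
    "Rs = blocks (dim_row M) d p" "Cs = blocks (dim_row M) d p"
proof -
  let ?n = "dim_row M"
  have Q: "partition_on {0..<?n} (set Rs)" and eq: "set Cs = set Rs"
    and sorted: "sorted_wrt (\<lambda>X Y. \<forall>x\<in>X. \<forall>y\<in>Y. x < y) Rs"
      "sorted_wrt (\<lambda>X Y. \<forall>x\<in>X. \<forall>y\<in>Y. x < y) Cs"
    using div symmetric_partition_iff[OF dim_col_symmetric[OF M]] by (auto simp: division_def)
  have CsRs: "Cs = Rs" by (rule sorted_partition_unique[OF Q _ eq sorted]) simp
  have less: "x < y" if "i < j" "j < length Rs" "x \<in> Rs ! i" "y \<in> Rs ! j" for i j x y
    using sorted_wrt_nth_less[OF sorted(1) that(1,2)] that(3,4) by blast
  define d where "d x = (SOME i. i < length Rs \<and> x \<in> Rs ! i)" for x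
  have d: "d x < length Rs \<and> x \<in> Rs ! d x" if "x \<in> {0..<?n}" for x
  proof -
    have "\<exists>X\<in>set Rs. x \<in> X" using that partition_onD1[OF Q] by auto
    then have "\<exists>i. i < length Rs \<and> x \<in> Rs ! i" by (auto simp: in_set_conv_nth)
    then show ?thesis unfolding d_def by (rule someI_ex)
  qed
  have sub: "Rs ! i \<subseteq> {0..<?n}" "Rs ! i \<noteq> {}" if "i < length Rs" for i
    using nth_mem[OF that] partition_onD1[OF Q] partition_onD3[OF Q] by auto
  have d_eq: "d x = i" if "i < length Rs" "x \<in> Rs ! i" for i x
  proof -
    have "d x < length Rs" "x \<in> Rs ! d x" using d[of x] sub(1)[OF that(1)] that(2) by auto
    then show ?thesis using less[of i "d x" x x] less[of "d x" i x x] that by (meson less_irrefl nat_neq_iff)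
  qed
  have img: "d ` {0..<?n} = {0..<length Rs}"
  proof (intro subset_antisym subsetI)
    fix i assume i: "i \<in> {0..<length Rs}"
    then obtain x where "x \<in> Rs ! i" using sub(2)[of i] by auto
    then show "i \<in> d ` {0..<?n}" using i sub(1)[of i] d_eq[of i x] by force
  qed (use d in auto)
  have "mono_on {0..<?n} d"
  proof (rule mono_onI, rule ccontr)
    fix x y assume "x \<in> {0..<?n}" "y \<in> {0..<?n}" "x \<le> y" "\<not> d x \<le> d y"
    then show False using less[of "d y" "d x" y x] d[of x] d[of y] by auto
  qed
  moreover have "Rs = blocks ?n d (length Rs)"
  proof (rule nth_equalityI)
    fix i assume i: "i < length Rs"
    have "Rs ! i = {x \<in> {0..<?n}. d x = i}" using d_eq[OF i] sub(1)[OF i] d by auto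
    then show "Rs ! i = blocks ?n d (length Rs) ! i" using i by simp
  qed simp
  ultimately show thesis using img CsRs by (intro that[of d "length Rs"]) auto
qed

abbreviation row_on :: "int mat \<Rightarrow> nat set \<Rightarrow> nat \<Rightarrow> nat \<Rightarrow> int" where
  "row_on M J x \<equiv> restrict (\<lambda>y. M $$ (x, y)) J"

text \<open>By symmetry of \<open>M\<close> the column submatrices are transposes of the row
  submatrices, so the condition on column parts repeats the one on row parts.\<close>

lemma wide_division_blocks_iff:
  assumes M: "symmetric_01_mat M" and mono: "mono_on {0..<dim_row M} d"
    and img: "d ` {0..<dim_row M} = {0..<p}"
  shows "wide_division k M (blocks (dim_row M) d p) (blocks (dim_row M) d p) \<longleftrightarrow>
    (\<forall>b<p. \<forall>j. j \<le> int b \<and> int b \<le> j + int k - 1 \<longrightarrow>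
       k \<le> card (row_on M {y \<in> {0..<dim_row M}. \<not> (j \<le> int (d y) \<and> int (d y) \<le> j + int k - 1)}
                  ` {x \<in> {0..<dim_row M}. d x = b}))"
    (is "_ \<longleftrightarrow> (\<forall>b<p. \<forall>j. _ \<longrightarrow> k \<le> card (row_on M (?J j) ` ?B b))")
proof -
  let ?n = "dim_row M"
  have dim: "dim_col M = ?n" by (rule dim_col_symmetric[OF M])
  have J: "{0..<?n} - window k (blocks ?n d p) j = ?J j" for j
    using img by (subst window_blocks) auto
  have rows: "card (set (rows (submatrix M (?B b) (?J j)))) = card (row_on M (?J j) ` ?B b)" for b j
    by (rule card_rows_submatrix) (auto simp: dim)
  have "rows (submatrix M (?B b) (?J j)) = cols (submatrix M (?J j) (?B b))" for b j
    by (subst transpose_submatrix[OF M, symmetric]) auto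
  then have cols: "card (set (cols (submatrix M (?J j) (?B b)))) = card (row_on M (?J j) ` ?B b)" for b j
    using rows by metis
  have "wide_row_part k M (blocks ?n d p) (blocks ?n d p) b \<longleftrightarrow>
      (\<forall>j. j \<le> int b \<and> int b \<le> j + int k - 1 \<longrightarrow> k \<le> card (row_on M (?J j) ` ?B b))"
    if "b < p" for b
    unfolding wide_row_part_def dim nth_blocks[OF that] J rows by (rule refl)
  moreover have "wide_col_part k M (blocks ?n d p) (blocks ?n d p) b \<longleftrightarrow>
      (\<forall>j. j \<le> int b \<and> int b \<le> j + int k - 1 \<longrightarrow> k \<le> card (row_on M (?J j) ` ?B b))"
    if "b < p" for b
    unfolding wide_col_part_def nth_blocks[OF that] J cols by (rule refl)
  ultimately show ?thesis
    unfolding wide_division_def length_blocks using division_blocks[OF M mono img] by blast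
qed

section \<open>Bounded stretch-width excludes wide divisions\<close>

lemma card_image_le_card_cover:
  assumes "finite \<Y>" "S \<subseteq> \<Union>\<Y>"
    and const: "\<And>Y x x'. Y \<in> \<Y> \<Longrightarrow> x \<in> Y \<Longrightarrow> x' \<in> Y \<Longrightarrow> f x = f x'"
  shows "card (f ` S) \<le> card \<Y>"
proof -
  have "f ` S \<subseteq> (\<lambda>Y. f (SOME x. x \<in> Y)) ` \<Y>"
  proof
    fix v assume "v \<in> f ` S"
    then obtain x Y where x: "v = f x" "x \<in> Y" "Y \<in> \<Y>" using assms(2) by blast
    then have "v = f (SOME x. x \<in> Y)" using const[OF x(3,2) someI[of "\<lambda>x. x \<in> Y", OF x(2)]] by simp
    then show "v \<in> (\<lambda>Y. f (SOME x. x \<in> Y)) ` \<Y>" using x(3) by blast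
  qed
  then show ?thesis using surj_card_le[OF assms(1)] by blast
qed

definition stretch_union :: "int mat \<Rightarrow> part set \<Rightarrow> part \<Rightarrow> nat set" where
  "stretch_union M Q X = \<Union>{C \<in> Q. C = X \<or> non_constant (submatrix M X C)}"

lemma row_stretch_alt:
  "row_stretch M (Q, Q) X = card {D \<in> Q. conflict D (stretch_union M Q X)}"
  by (simp add: row_stretch_def stretch_union_def)

text \<open>The part containing \<open>y\<close> is not among those forming the union, so its zone
  with \<open>X\<close> is constant.\<close>

lemma entry_eq_outside_stretch_union:
  assumes M: "symmetric_01_mat M" and Q: "partition_on {0..<dim_row M} Q" and X: "X \<in> Q"
    and x: "x \<in> X" "x' \<in> X" and y: "y < dim_row M" "y \<notin> stretch_union M Q X"
  shows "M $$ (x, y) = M $$ (x', y)"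
proof -
  have "y \<in> \<Union>Q" using y(1) by (simp add: partition_onD1[OF Q, symmetric])
  then obtain C where C: "C \<in> Q" "y \<in> C" by blast
  have "\<not> non_constant (submatrix M X C)" using y(2) C by (auto simp: stretch_union_def)
  moreover have sub: "X \<subseteq> {0..<dim_row M}" "C \<subseteq> {0..<dim_col M}"
    using X C(1) partition_onD1[OF Q] by (auto simp: dim_col_symmetric[OF M])
  ultimately show ?thesis unfolding non_constant_submatrix[OF sub] using x C(2) by blast
qed

lemma index_span_mem: "finite X \<Longrightarrow> x \<in> X \<Longrightarrow> x \<in> index_span X"
  by (simp add: index_span_def)

section \<open>From numbers of conflicting parts to distances between blocks\<close>

context
  fixes M :: "int mat" and d :: "nat \<Rightarrow> nat" and p c m :: nat and Q :: "part set"
  assumes M: "symmetric_01_mat M" and mono: "mono_on {0..<dim_row M} d"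
    and img: "d ` {0..<dim_row M} = {0..<p}"
    and Q: "partition_on {0..<dim_row M} Q"
    and c: "\<And>X. X \<in> Q \<Longrightarrow> row_stretch M (Q, Q) X \<le> c"
    and m: "\<And>X. X \<in> Q \<Longrightarrow> card (d ` X) \<le> m"
begin

lemma stretch_union_in:
  assumes "X \<in> Q"
  shows "X \<subseteq> stretch_union M Q X" "stretch_union M Q X \<subseteq> {0..<dim_row M}"
  using assms partition_onD1[OF Q] by (auto simp: stretch_union_def)

text \<open>All blocks from the first to the last one met by the union are met by parts conflicting
  with it. These are at most \<open>c\<close> parts, each meeting at most \<open>m\<close>
  blocks.\<close>

lemma stretch_union_dist:
  assumes X: "X \<in> Q" and x: "x \<in> stretch_union M Q X" and y: "y \<in> stretch_union M Q X"
  shows "d y < d x + c * m"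
proof -
  let ?U = "stretch_union M Q X" and ?n = "dim_row M"
  have U: "?U \<subseteq> {0..<?n}" by (rule stretch_union_in(2)[OF X])
  then have fin: "finite ?U" by (rule finite_subset) simp
  have mem: "Min ?U \<in> ?U" "Max ?U \<in> ?U" using fin x by (auto intro: Min_in Max_in)
  have "Min ?U \<le> x" "y \<le> Max ?U" using x y fin by auto
  then have Min: "d (Min ?U) \<le> d x" and Max: "d y \<le> d (Max ?U)"
    using mono_onD[OF mono] x y mem U by blast+
  define \<D> where "\<D> = {D \<in> Q. conflict D ?U}"
  have finD: "finite \<D>" unfolding \<D>_def using finite_elements[OF _ Q] by simp
  have "{d (Min ?U)..d (Max ?U)} \<subseteq> (\<Union>D\<in>\<D>. d ` D)"
  proof
    fix b assume b: "b \<in> {d (Min ?U)..d (Max ?U)}"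
    \<comment> \<open>No block is empty, since \<open>d\<close> is onto; a block strictly between
      the extreme ones lies inside the span by monotonicity, and the extreme ones contain the
      minimum and the maximum.\<close>
    have "\<exists>w\<in>{0..<?n}. w \<in> {Min ?U..Max ?U} \<and> d w = b"
    proof (cases "b = d (Min ?U) \<or> b = d (Max ?U)")
      case True
      then show ?thesis using mem U fin x by (metis Min_le Max_ge atLeastAtMost_iff order_refl subsetD)
    next
      case False
      have "d (Max ?U) \<in> {0..<p}" using mem U img by blast
      then have "b \<in> d ` {0..<?n}" using b img by auto
      then obtain w where w: "w \<in> {0..<?n}" "d w = b" by blast
      have "d (Min ?U) < d w" "d w < d (Max ?U)" using False b w(2) by auto
      then have "Min ?U < w" "w < Max ?U" using mono_on_less_imp_less[OF mono] w(1) mem U by blast+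
      then show ?thesis using w by (intro bexI[of _ w]) simp_all
    qed
    then obtain w where w: "w \<in> {0..<?n}" "w \<in> index_span ?U" "d w = b"
      by (auto simp: index_span_def)
    then obtain D where D: "D \<in> Q" "w \<in> D" using partition_onD1[OF Q] by auto
    then have "finite D" using partition_onD1[OF Q] by (metis Union_upper finite_atLeastLessThan finite_subset)
    then have "D \<in> \<D>" unfolding \<D>_def conflict_def using D w(2) index_span_mem by blast
    then show "b \<in> (\<Union>D\<in>\<D>. d ` D)" using D(2) w(3) by blast
  qed
  moreover have "finite (\<Union>D\<in>\<D>. d ` D)"
  proof (rule finite_subset)
    show "(\<Union>D\<in>\<D>. d ` D) \<subseteq> d ` {0..<?n}" using partition_onD1[OF Q] by (auto simp: \<D>_def)
  qed simp
  ultimately have "card {d (Min ?U)..d (Max ?U)} \<le> card (\<Union>D\<in>\<D>. d ` D)" by (intro card_mono)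
  also have "\<dots> \<le> (\<Sum>D\<in>\<D>. card (d ` D))" by (rule card_UN_le[OF finD])
  also have "\<dots> \<le> card \<D> * m" using m by (intro sum_bounded_above[of \<D> _ m, simplified]) (auto simp: \<D>_def)
  also have "\<dots> \<le> c * m" using c[OF X] by (simp add: row_stretch_alt \<D>_def)
  finally show ?thesis using Min Max by simp
qed

text \<open>A part \<open>Y\<close> meeting the block has an index in the span of \<open>X\<close>,
  so it conflicts with the stretch union of \<open>X\<close>; there are at most \<open>c\<close>
  such parts. The stretch union of \<open>Y\<close> itself stays close to block \<open>b\<close>,
  hence misses \<open>J\<close>, and all rows of \<open>Y\<close> agree on \<open>J\<close>.\<close>

lemma card_rows_block_le:
  assumes X: "X \<in> Q" and b: "{x \<in> {0..<dim_row M}. d x = b} \<subseteq> index_span X"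
    and J: "J \<subseteq> {y \<in> {0..<dim_row M}. \<not> (int b - int (c * m) \<le> int (d y) \<and> int (d y) \<le> int b + int (c * m))}"
  shows "card (row_on M J ` {x \<in> {0..<dim_row M}. d x = b}) \<le> c"
proof -
  let ?n = "dim_row M" and ?B = "{x \<in> {0..<dim_row M}. d x = b}"
  define \<Y> where "\<Y> = {Y \<in> Q. Y \<inter> ?B \<noteq> {}}"
  have finQ: "finite Q" using finite_elements[OF _ Q] by simp
  have fin: "finite Y" if "Y \<in> Q" for Y
    using that partition_onD1[OF Q] by (metis Union_upper finite_atLeastLessThan finite_subset)
  have const: "row_on M J x = row_on M J x'" if Y: "Y \<in> \<Y>" and x: "x \<in> Y" "x' \<in> Y" for Y x x'
  proof (rule restrict_ext)
    fix y assume y: "y \<in> J"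
    have YQ: "Y \<in> Q" using Y by (simp add: \<Y>_def)
    obtain z where z: "z \<in> Y" "d z = b" using Y by (auto simp: \<Y>_def)
    have zU: "z \<in> stretch_union M Q Y" using z stretch_union_in(1)[OF YQ] by auto
    have "y \<notin> stretch_union M Q Y"
    proof
      assume yU: "y \<in> stretch_union M Q Y"
      define r where "r = c * m"
      have "d y < b + r" "b < d y + r"
        using stretch_union_dist[OF YQ zU yU] stretch_union_dist[OF YQ yU zU] z(2) by (simp_all add: r_def)
      moreover have "\<not> (int b - int r \<le> int (d y) \<and> int (d y) \<le> int b + int r)"
        using y J by (auto simp: r_def)
      ultimately show False by linarith
    qed
    then show "M $$ (x, y) = M $$ (x', y)"
      using y J by (intro entry_eq_outside_stretch_union[OF M Q YQ x]) auto
  qed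
  have "?B \<subseteq> \<Union>Q" by (auto simp: partition_onD1[OF Q, symmetric])
  then have "?B \<subseteq> \<Union>\<Y>" by (auto simp: \<Y>_def)
  moreover have "finite \<Y>" using finQ by (simp add: \<Y>_def)
  ultimately have "card (row_on M J ` ?B) \<le> card \<Y>"
    using const by (intro card_image_le_card_cover[where f = "row_on M J"])
  also have "\<dots> \<le> card {D \<in> Q. conflict D (stretch_union M Q X)}"
  proof (rule card_mono)
    show "\<Y> \<subseteq> {D \<in> Q. conflict D (stretch_union M Q X)}"
    proof
      fix Y assume Y: "Y \<in> \<Y>"
      then obtain z where z: "z \<in> Y" "z \<in> ?B" by (auto simp: \<Y>_def)
      have "X \<noteq> {}" using X partition_onD3[OF Q] by auto
      have "finite (stretch_union M Q X)" using stretch_union_in(2)[OF X] finite_subset by blast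
      then have "index_span X \<subseteq> index_span (stretch_union M Q X)"
        unfolding index_span_def using stretch_union_in(1)[OF X] \<open>X \<noteq> {}\<close>
        by (auto intro: Min_antimono Max_mono order_trans)
      then have "z \<in> index_span (stretch_union M Q X)" using z b by blast
      moreover have "z \<in> index_span Y" using z Y fin index_span_mem by (auto simp: \<Y>_def)
      ultimately show "Y \<in> {D \<in> Q. conflict D (stretch_union M Q X)}"
        using Y by (auto simp: conflict_def \<Y>_def)
    qed
  qed (use finQ in simp)
  also have "\<dots> \<le> c" using c[OF X] by (simp add: row_stretch_alt)
  finally show ?thesis .
qed

end

text \<open>If \<open>X\<close> reached beyond the block following that of \<open>Min X\<close>,
  this following block would lie strictly between \<open>Min X\<close> and
  \<open>Max X\<close>.\<close>

lemma card_image_le_2: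
  fixes d :: "nat \<Rightarrow> nat"
  assumes mono: "mono_on {0..<n} d" and img: "d ` {0..<n} = {0..<p}"
    and X: "X \<subseteq> {0..<n}" "X \<noteq> {}"
    and no_block: "\<And>b. b < p \<Longrightarrow> \<not> {x \<in> {0..<n}. d x = b} \<subseteq> index_span X"
  shows "card (d ` X) \<le> 2"
proof -
  have fin: "finite X" using X(1) finite_subset by blast
  have mem: "Min X \<in> {0..<n}" "Max X \<in> {0..<n}" using Min_in[OF fin X(2)] Max_in[OF fin X(2)] X(1) by auto
  have le: "d (Max X) \<le> Suc (d (Min X))"
  proof (rule ccontr)
    assume less: "\<not> d (Max X) \<le> Suc (d (Min X))"
    have "d (Max X) \<in> {0..<p}" using mem img by blast
    then have "Suc (d (Min X)) < p" using less by auto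
    moreover have "{x \<in> {0..<n}. d x = Suc (d (Min X))} \<subseteq> index_span X"
    proof
      fix x assume x: "x \<in> {x \<in> {0..<n}. d x = Suc (d (Min X))}"
      have "d (Min X) < d x" "d x < d (Max X)" using x less by auto
      then have "Min X < x" "x < Max X"
        using mono_on_less_imp_less[OF mono] x mem by blast+
      then show "x \<in> index_span X" by (simp add: index_span_def)
    qed
    ultimately show False using no_block by blast
  qed
  have "d ` X \<subseteq> {d (Min X), Suc (d (Min X))}"
  proof
    fix v assume "v \<in> d ` X"
    then obtain x where x: "x \<in> X" "v = d x" by blast
    have "x \<in> {0..<n}" "Min X \<le> x" "x \<le> Max X" using x X(1) fin by auto
    then have "d (Min X) \<le> d x" "d x \<le> d (Max X)"
      using mono_onD[OF mono] mem by blast+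
    then show "v \<in> {d (Min X), Suc (d (Min X))}" using le x(2) by auto
  qed
  then have "card (d ` X) \<le> card {d (Min X), Suc (d (Min X))}" by (intro card_mono) auto
  then show ?thesis by simp
qed

text \<open>
  Stop at the first partition with a part whose span contains a block of the division. One step
  before, every part meets at most two blocks, so now every part meets at most four; hence the
  parts meeting that block, of which there are at most c, have constant zones outside a short window.
\<close>

lemma no_wide_division:
  assumes M: "symmetric_01_mat M" and P: "symmetric_partition_sequence M P"
    and le: "\<And>t. t \<in> {1..dim_row M} \<Longrightarrow> stretch_value M (P t) \<le> c"
  shows "\<not> wide_division (8 * c + 2) M Rs Cs"
proof
  let ?n = "dim_row M" and ?k = "8 * c + 2"
  assume wide: "wide_division ?k M Rs Cs"
  then have "division M Rs Cs" by (simp add: wide_division_def)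
  from division_as_blocks[OF M this] obtain d p where mono: "mono_on {0..<?n} d"
    and img: "d ` {0..<?n} = {0..<p}" and "Rs = blocks ?n d p" "Cs = blocks ?n d p" by blast
  then have "wide_division ?k M (blocks ?n d p) (blocks ?n d p)" using wide by simp
  then have wide: "?k \<le> card (row_on M {y \<in> {0..<?n}. \<not> (j \<le> int (d y) \<and> int (d y) \<le> j + int ?k - 1)}
                  ` {x \<in> {0..<?n}. d x = b})"
    if "b < p" "j \<le> int b" "int b \<le> j + int ?k - 1" for b j
    using that unfolding wide_division_blocks_iff[OF M mono img] by blast
  have n: "0 < ?n" using M by (simp add: symmetric_01_mat_def)
  define Q where "Q t = fst (P t)" for t
  have sp: "symmetric_partition M (P t)" if "t \<in> {1..?n}" for t
    using P that by (simp add: symmetric_partition_sequence_def Let_def)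
  have PQ: "P t = (Q t, Q t)" and part: "partition_on {0..<?n} (Q t)" if "t \<in> {1..?n}" for t
  proof -
    have "symmetric_partition M (fst (P t), snd (P t))" using sp[OF that] by simp
    then have "snd (P t) = Q t" "partition_on {0..<?n} (Q t)"
      unfolding symmetric_partition_iff[OF dim_col_symmetric[OF M]] Q_def by auto
    then show "P t = (Q t, Q t)" "partition_on {0..<?n} (Q t)" by (simp_all add: Q_def prod_eq_iff)
  qed
  have stretch: "row_stretch M (Q t, Q t) X \<le> c" if "t \<in> {1..?n}" "X \<in> Q t" for t X
    using le[OF that(1)] that(2) stretch_value_le_iff[OF M part[OF that(1)]] PQ[OF that(1)] by simp
  have sub: "X \<subseteq> {0..<?n}" "X \<noteq> {}" if "t \<in> {1..?n}" "X \<in> Q t" for t X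
    using partition_onD1[OF part[OF that(1)]] partition_onD3[OF part[OF that(1)]] that(2) by auto
  define bad where "bad t \<longleftrightarrow> (\<exists>X\<in>Q t. \<exists>b<p. {x \<in> {0..<?n}. d x = b} \<subseteq> index_span X)" for t
  \<comment> \<open>A block inside the span of a singleton has at most one row, while wideness
    demands two or more. The summand \<open>2\<close> in \<open>?k\<close> ensures this even for
    \<open>c = 0\<close>.\<close>
  have "\<not> bad ?n"
  proof
    assume "bad ?n"
    then obtain x b where b: "b < p" "{x \<in> {0..<?n}. d x = b} \<subseteq> {x}"
      using P by (auto simp: bad_def Q_def symmetric_partition_sequence_def Let_def index_span_def)
    let ?f = "row_on M {y \<in> {0..<?n}. \<not> (int b \<le> int (d y) \<and> int (d y) \<le> int b + int ?k - 1)}"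
    have "?k \<le> card (?f ` {x \<in> {0..<?n}. d x = b})" using b(1) by (intro wide) auto
    also have "\<dots> \<le> card (?f ` {x})" using b(2) by (intro card_mono image_mono) auto
    finally show False by simp
  qed
  moreover have "bad 1"
  proof -
    have "card (Q 1) = 1" using P by (simp add: symmetric_partition_sequence_def Let_def Q_def)
    then obtain X where X: "Q 1 = {X}" by (auto simp: card_1_singleton_iff)
    then have "X = {0..<?n}" using partition_onD1[OF part[of 1]] n by simp
    moreover have "d 0 < p" using img n by force
    moreover have "x \<in> index_span {0..<?n}" if "x < ?n" for x using that by (intro index_span_mem) auto
    ultimately show ?thesis using X unfolding bad_def by auto
  qed
  \<comment> \<open>Indices decrease along the sequence, so \<open>Suc t\<close> is the partition
    just before \<open>t\<close>. Any place where \<open>bad\<close> switches serves the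
    purpose.\<close>
  ultimately obtain t where t: "1 \<le> t" "t < ?n" "bad t" "\<not> bad (Suc t)"
    using dec_induct[of 1 ?n bad] n by (metis Suc_leI One_nat_def)
  have tn: "t \<in> {1..?n}" "Suc t \<in> {1..?n}" using t by auto
  have two: "card (d ` X) \<le> 2" if "X \<in> Q (Suc t)" for X
    using t(4) that sub[OF tn(2) that] by (intro card_image_le_2[OF mono img]) (auto simp: bad_def)
  have "merges_to (Q (Suc t), Q (Suc t)) (Q t, Q t)"
  proof -
    have "merges_to (P (Suc t)) (P t)"
      using P t(1,2) unfolding symmetric_partition_sequence_def Let_def by simp
    then show ?thesis using PQ[OF tn(1)] PQ[OF tn(2)] by simp
  qed
  then obtain A B where AB: "A \<in> Q (Suc t)" "B \<in> Q (Suc t)"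
    and Qt: "Q t = insert (A \<union> B) (Q (Suc t) - {A, B})" by (auto simp: merges_to_def)
  have four: "card (d ` X) \<le> 4" if "X \<in> Q t" for X
  proof (cases "X = A \<union> B")
    case True
    then show ?thesis using two[OF AB(1)] two[OF AB(2)] card_Un_le[of "d ` A" "d ` B"]
      by (simp add: image_Un)
  next
    case False
    then show ?thesis using two[of X] that Qt by auto
  qed
  obtain X b where X: "X \<in> Q t" "b < p" "{x \<in> {0..<?n}. d x = b} \<subseteq> index_span X"
    using t(3) by (auto simp: bad_def)
  \<comment> \<open>The factor \<open>4\<close> is the number of blocks that a part may meet.
    Starting here, \<open>?k\<close> blocks cover the distance \<open>4 * c\<close> on both sides of
    \<open>b\<close>.\<close>
  let ?j = "int b - int (c * 4)"
  let ?J = "{y \<in> {0..<?n}. \<not> (?j \<le> int (d y) \<and> int (d y) \<le> ?j + int ?k - 1)}"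
  have "?k \<le> card (row_on M ?J ` {x \<in> {0..<?n}. d x = b})" using X(2) by (intro wide) auto
  also have "\<dots> \<le> c"
    by (rule card_rows_block_le[OF M mono img part[OF tn(1)] stretch[OF tn(1)] four X(1,3)]) auto
  finally show False by simp
qed

section \<open>Excluding wide divisions bounds the stretch-width\<close>

text \<open>
  The indices of each block are split according to their rows restricted to the columns whose
  block is at distance more than r. Fixing this radius, instead of one window per block, makes
  the classes only grow when blocks are merged.
\<close>

definition twins :: "int mat \<Rightarrow> nat \<Rightarrow> (nat \<Rightarrow> nat) \<Rightarrow> (nat \<times> nat) set" where
  "twins M r d = {(x, y). x < dim_row M \<and> y < dim_row M \<and> d x = d y \<and>
     (\<forall>z<dim_row M. int r < \<bar>int (d z) - int (d x)\<bar> \<longrightarrow> M $$ (x, z) = M $$ (y, z))}"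

abbreviation twin_classes :: "int mat \<Rightarrow> nat \<Rightarrow> (nat \<Rightarrow> nat) \<Rightarrow> part set" where
  "twin_classes M r d \<equiv> {0..<dim_row M} // twins M r d"

lemma equiv_twins: "equiv {0..<dim_row M} (twins M r d)"
proof (rule equivI)
  show "twins M r d \<subseteq> {0..<dim_row M} \<times> {0..<dim_row M}" by (auto simp: twins_def)
  show "refl_on {0..<dim_row M} (twins M r d)" by (auto simp: refl_on_def twins_def)
  show "sym (twins M r d)" by (auto simp: sym_def twins_def)
  show "trans (twins M r d)" by (auto simp: trans_def twins_def)
qed

lemma partition_on_classes: "partition_on {0..<dim_row M} (twin_classes M r d)"
  by (rule partition_on_quotient[OF equiv_twins])

lemma classes_same_block:
  assumes "X \<in> twin_classes M r d" "x \<in> X" "y \<in> X"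
  shows "d x = d y"
  using in_quotient_imp_in_rel[OF equiv_twins assms(1), of x y] assms(2,3) by (auto simp: twins_def)

lemma refines_quotient:
  assumes "equiv A R" "equiv A R'" "R \<subseteq> R'"
  shows "refines A (A // R) (A // R')"
  unfolding refines_def
proof (intro conjI ballI partition_on_quotient assms(1,2))
  fix X assume "X \<in> A // R"
  then obtain x where "x \<in> A" "X = R `` {x}" by (rule quotientE)
  then have "R' `` {x} \<in> A // R'" "X \<subseteq> R' `` {x}" using assms(3) by (auto intro: quotientI)
  then show "\<exists>Y\<in>A // R'. X \<subseteq> Y" by blast
qed

text \<open>Every part of the coarser partition contains a part of the finer one, and disjointness
  makes the choice injective. As \<open>S\<close> is arbitrary, this serves both for classes that
  grow and for partitions midway through a merge.\<close>

lemma card_parts_within_le: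
  assumes PQ: "refines A P Q" and "finite A"
  shows "card {X \<in> Q. X \<subseteq> S} \<le> card {X \<in> P. X \<subseteq> S}"
proof -
  have P: "partition_on A P" and Q: "partition_on A Q" using PQ by (auto simp: refines_def)
  have ex: "\<exists>Y. Y \<in> P \<and> Y \<subseteq> X" if X: "X \<in> Q" for X
  proof -
    obtain x where x: "x \<in> X" using X partition_onD3[OF Q] by (metis ex_in_conv)
    have "\<Union>P = \<Union>Q" using partition_onD1[OF P] partition_onD1[OF Q] by (rule subst)
    then obtain Y where Y: "Y \<in> P" "x \<in> Y" using x X by blast
    obtain Z where Z: "Z \<in> Q" "Y \<subseteq> Z" using PQ Y(1) by (auto simp: refines_def)
    then have "Z = X" using partition_on_part_eq[OF Q Z(1) X _ x] Y(2) by blast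
    then show ?thesis using Y(1) Z(2) by blast
  qed
  define f where "f X = (SOME Y. Y \<in> P \<and> Y \<subseteq> X)" for X
  have f: "f X \<in> P" "f X \<subseteq> X" if "X \<in> Q" for X
    using someI_ex[OF ex[OF that]] by (auto simp: f_def)
  show ?thesis
  proof (rule card_inj_on_le)
    show "inj_on f {X \<in> Q. X \<subseteq> S}"
    proof (rule inj_onI)
      fix X Y assume "X \<in> {X \<in> Q. X \<subseteq> S}" "Y \<in> {X \<in> Q. X \<subseteq> S}" and eq: "f X = f Y"
      then have XY: "X \<in> Q" "Y \<in> Q" by auto
      obtain x where "x \<in> f X" using f(1)[OF XY(1)] partition_onD3[OF P] by (metis ex_in_conv)
      then have "x \<in> X" "x \<in> Y" using f(2)[OF XY(1)] f(2)[OF XY(2)] eq by auto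
      then show "X = Y" by (rule partition_on_part_eq[OF Q XY])
    qed
    show "f ` {X \<in> Q. X \<subseteq> S} \<subseteq> {X \<in> P. X \<subseteq> S}" using f by blast
    show "finite {X \<in> P. X \<subseteq> S}" using finite_elements[OF assms(2) P] by simp
  qed
qed

text \<open>A part lies in one block, and its zone with any part more than \<open>r\<close> blocks
  away is constant. So the stretch union spans at most \<open>2 * r + 1\<close> blocks, each
  containing at most \<open>m\<close> parts.\<close>

lemma row_stretch_le:
  assumes M: "symmetric_01_mat M" and mono: "mono_on {0..<dim_row M} d"
    and ref: "refines {0..<dim_row M} P (twin_classes M r d)"
    and m: "\<And>b. card {X \<in> P. X \<subseteq> d -` {b}} \<le> m"
    and Y: "Y \<in> P"
  shows "row_stretch M (P, P) Y \<le> (2 * r + 1) * m"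
proof -
  let ?n = "dim_row M" and ?U = "stretch_union M P Y"
  have P: "partition_on {0..<?n} P" using ref by (simp add: refines_def)
  have sub: "X \<subseteq> {0..<?n}" "X \<noteq> {}" if "X \<in> P" for X
    using that partition_onD1[OF P] partition_onD3[OF P] by auto
  have fin: "finite X" if "X \<in> P" for X using sub(1)[OF that] finite_subset by blast
  have tw: "(x, x') \<in> twins M r d" if X: "X \<in> P" "x \<in> X" "x' \<in> X" for X x x'
  proof -
    obtain Z where Z: "Z \<in> twin_classes M r d" "X \<subseteq> Z" using ref X(1) by (auto simp: refines_def)
    show ?thesis using in_quotient_imp_in_rel[OF equiv_twins Z(1), of x x'] Z(2) X(2,3) by auto
  qed
  have same: "d x = d x'" if "X \<in> P" "x \<in> X" "x' \<in> X" for X x x'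
    using tw[OF that] by (simp add: twins_def)
  have eq: "M $$ (x, z) = M $$ (x', z)"
    if "X \<in> P" "x \<in> X" "x' \<in> X" "z < ?n" "int r < \<bar>int (d z) - int (d x)\<bar>" for X x x' z
    using tw[OF that(1-3)] that(4,5) by (simp add: twins_def)
  obtain y where y: "y \<in> Y" using sub(2)[OF Y] by blast
  have near: "\<bar>int (d z) - int (d y)\<bar> \<le> int r" if z: "z \<in> ?U" for z
  proof (rule ccontr)
    assume far: "\<not> \<bar>int (d z) - int (d y)\<bar> \<le> int r"
    obtain C where C: "C \<in> P" "z \<in> C" "C = Y \<or> non_constant (submatrix M Y C)"
      using z by (auto simp: stretch_union_def)
    have "C \<noteq> Y" using far same[OF Y y, of z] C(2) by auto
    moreover have CM: "C \<subseteq> {0..<dim_col M}" using sub(1)[OF C(1)] by (simp add: dim_col_symmetric[OF M])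
    ultimately obtain y1 z1 y2 z2 where
      w: "y1 \<in> Y" "z1 \<in> C" "y2 \<in> Y" "z2 \<in> C" "M $$ (y1, z1) \<noteq> M $$ (y2, z2)"
      using C(3) unfolding non_constant_submatrix[OF sub(1)[OF Y] CM] by blast
    have lt: "y1 < ?n" "y2 < ?n" "z1 < ?n" "z2 < ?n"
      using w sub(1)[OF Y] sub(1)[OF C(1)] by auto
    have dd: "d y1 = d y" "d y2 = d y" "d z1 = d z" "d z2 = d z"
      using same[OF Y _ y] same[OF C(1) _ C(2)] w by auto
    \<comment> \<open>Constancy in both directions: the rows of \<open>Y\<close> agree in the far
      column \<open>z1\<close>, and after transposing, the rows of \<open>C\<close> agree in the far
      column \<open>y2\<close>.\<close>
    have "M $$ (y1, z1) = M $$ (y2, z1)" using far dd lt by (intro eq[OF Y w(1,3)]) auto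
    also have "\<dots> = M $$ (z1, y2)" using lt by (intro symmetric_entry[OF M])
    also have "\<dots> = M $$ (z2, y2)" using far dd lt by (intro eq[OF C(1) w(2,4)]) auto
    also have "\<dots> = M $$ (y2, z2)" using lt by (intro symmetric_entry[OF M])
    finally show False using w(5) by simp
  qed
  have U: "?U \<subseteq> {0..<?n}" "y \<in> ?U" using sub(1) Y y by (auto simp: stretch_union_def)
  have finU: "finite ?U" using U(1) finite_subset by blast
  have memU: "Min ?U \<in> ?U" "Max ?U \<in> ?U" using finU U(2) by (auto intro: Min_in Max_in)
  \<comment> \<open>As \<open>D\<close> lies in one block, monotonicity puts its whole span there,
    so a common point of the two spans determines that block. Truncation in \<open>d y - r\<close>
    only omits block numbers that do not exist.\<close>
  have "{D \<in> P. conflict D ?U} \<subseteq> (\<Union>b\<in>{d y - r..d y + r}. {X \<in> P. X \<subseteq> d -` {b}})"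
  proof
    fix D assume "D \<in> {D \<in> P. conflict D ?U}"
    then have D: "D \<in> P" and "\<exists>w. w \<in> index_span D \<inter> index_span ?U"
      unfolding conflict_def by blast+
    then obtain w where w: "Min D \<le> w" "w \<le> Max D" "Min ?U \<le> w" "w \<le> Max ?U"
      unfolding index_span_def by fastforce
    have memD: "Min D \<in> D" "Max D \<in> D" using fin[OF D] sub(2)[OF D] by auto
    have n: "Min D \<in> {0..<?n}" "Max D \<in> {0..<?n}" "Min ?U \<in> {0..<?n}" "Max ?U \<in> {0..<?n}"
      using memD sub(1)[OF D] memU U(1) by blast+
    then have wn: "w \<in> {0..<?n}" using w by auto
    have "d (Min D) \<le> d w" "d w \<le> d (Max D)" "d (Min ?U) \<le> d w" "d w \<le> d (Max ?U)"
      using mono_onD[OF mono] n wn w by blast+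
    moreover have "d (Min D) = d (Max D)" by (rule same[OF D memD])
    ultimately have "d w \<in> {d y - r..d y + r}" "d (Min D) = d w"
      using near[OF memU(1)] near[OF memU(2)] by auto
    moreover from this have "D \<subseteq> d -` {d w}" using same[OF D memD(1)] by auto
    ultimately show "D \<in> (\<Union>b\<in>{d y - r..d y + r}. {X \<in> P. X \<subseteq> d -` {b}})" using D by blast
  qed
  moreover have "finite P" using finite_elements[OF _ P] by simp
  ultimately have "row_stretch M (P, P) Y \<le> card (\<Union>b\<in>{d y - r..d y + r}. {X \<in> P. X \<subseteq> d -` {b}})"
    unfolding row_stretch_alt by (intro card_mono) auto
  also have "\<dots> \<le> (\<Sum>b\<in>{d y - r..d y + r}. card {X \<in> P. X \<subseteq> d -` {b}})"
    by (rule card_UN_le) simp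
  also have "\<dots> \<le> (\<Sum>b\<in>{d y - r..d y + r}. m)" by (intro sum_mono m)
  also have "\<dots> = card {d y - r..d y + r} * m" by simp
  also have "\<dots> \<le> (2 * r + 1) * m" by (intro mult_le_mono1) auto
  finally show ?thesis .
qed

section \<open>Merging two neighbouring blocks\<close>

text \<open>Composed after a block numbering, it merges the blocks \<open>i\<close> and
  \<open>Suc i\<close> and closes the gap.\<close>

definition contract :: "nat \<Rightarrow> nat \<Rightarrow> nat" where
  "contract i v = (if v \<le> i then v else v - 1)"

lemma contract_mono: "v \<le> w \<Longrightarrow> contract i v \<le> contract i w"
  by (auto simp: contract_def)

lemma contract_dist: "\<bar>int (contract i v) - int (contract i w)\<bar> \<le> \<bar>int v - int w\<bar>"
  by (auto simp: contract_def)

lemma contract_image: "i < q \<Longrightarrow> contract i ` {0..<Suc q} = {0..<q}"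
proof (intro subset_antisym subsetI)
  fix v assume "i < q" "v \<in> {0..<q}"
  then show "v \<in> contract i ` {0..<Suc q}"
    by (intro image_eqI[of _ _ "if v \<le> i then v else Suc v"]) (auto simp: contract_def)
qed (auto simp: contract_def split: if_splits)

text \<open>\<open>contract i\<close> never increases the distance of two block numbers, so every
  column compared after the merge was already compared before it.\<close>

lemma twins_contract: "twins M r d \<subseteq> twins M r (contract i \<circ> d)"
proof
  fix e assume e: "e \<in> twins M r d"
  obtain x y where xy: "e = (x, y)" by (cases e)
  have "int r < \<bar>int (d z) - int (d x)\<bar>"
    if "int r < \<bar>int (contract i (d z)) - int (contract i (d x))\<bar>" for z
    using that contract_dist[of i "d z" "d x"] by linarith
  then show "e \<in> twins M r (contract i \<circ> d)" using e by (auto simp: xy twins_def)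
qed

lemma refines_classes_contract:
  "refines {0..<dim_row M} (twin_classes M r d) (twin_classes M r (contract i \<circ> d))"
  by (rule refines_quotient[OF equiv_twins equiv_twins twins_contract])

text \<open>A class never leaves its block, so the classes contained in the preimage of
  \<open>b\<close> are all the classes of block \<open>b\<close>. This is the invariant of the
  greedy merging.\<close>

definition thin :: "int mat \<Rightarrow> nat \<Rightarrow> nat \<Rightarrow> (nat \<Rightarrow> nat) \<Rightarrow> bool" where
  "thin M r k d \<longleftrightarrow> (\<forall>b. card {X \<in> twin_classes M r d. X \<subseteq> d -` {b}} < k)"

definition bounded_stretch :: "int mat \<Rightarrow> nat \<Rightarrow> part set \<Rightarrow> bool" where
  "bounded_stretch M c P \<longleftrightarrow> (\<forall>X\<in>P. row_stretch M (P, P) X \<le> c)"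

text \<open>Apart from the merged block, every block is an old one, possibly renumbered; its classes
  can only have been united, so their number does not grow.\<close>

lemma thin_contract:
  assumes thin: "thin M r k d"
    and i: "card {X \<in> twin_classes M r (contract i \<circ> d). X \<subseteq> (contract i \<circ> d) -` {i}} < k"
  shows "thin M r k (contract i \<circ> d)"
  unfolding thin_def
proof
  fix b
  let ?d = "contract i \<circ> d"
  have le: "card {X \<in> twin_classes M r ?d. X \<subseteq> S} \<le> card {X \<in> twin_classes M r d. X \<subseteq> S}" for S
    by (rule card_parts_within_le[OF refines_classes_contract]) simp
  have less: "card {X \<in> twin_classes M r ?d. X \<subseteq> d -` {b'}} < k" for b'
    by (rule le_less_trans[OF le thin[unfolded thin_def, rule_format]])
  consider "b < i" | "b = i" | "i < b" by linarith
  then show "card {X \<in> twin_classes M r ?d. X \<subseteq> ?d -` {b}} < k"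
  proof cases
    case 1
    then have eq: "?d -` {b} = d -` {b}" by (auto simp: contract_def split: if_splits)
    show ?thesis unfolding eq by (rule less)
  next
    case 2
    then show ?thesis using i by simp
  next
    case 3
    then have eq: "?d -` {b} = d -` {Suc b}" by (auto simp: contract_def split: if_splits)
    show ?thesis unfolding eq by (rule less)
  qed
qed

text \<open>A block after the merge consists of at most two old blocks with fewer than
  \<open>k\<close> classes each, so a partition in between has at most \<open>2 * k\<close> parts in
  it. The stretch is measured against the merged division, whose classes the partition still
  refines.\<close>

lemma merge_steps_contract:
  assumes M: "symmetric_01_mat M" and mono: "mono_on {0..<dim_row M} d" and thin: "thin M r k d"
  shows "(merge_step (bounded_stretch M ((2 * r + 1) * (2 * k))))\<^sup>*\<^sup>*
    (twin_classes M r d) (twin_classes M r (contract i \<circ> d))"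
proof (rule merge_steps_refines[OF refines_classes_contract finite_atLeastLessThan])
  let ?d = "contract i \<circ> d"
  have mono': "mono_on {0..<dim_row M} ?d"
    using mono_onD[OF mono] by (auto intro!: mono_onI contract_mono)
  have fin: "finite (twin_classes M r d)" by (rule finite_elements[OF _ partition_on_classes]) simp
  fix P assume P: "refines {0..<dim_row M} (twin_classes M r d) P"
    "refines {0..<dim_row M} P (twin_classes M r ?d)"
  have "card {X \<in> P. X \<subseteq> ?d -` {b}} \<le> 2 * k" for b
  proof -
    have "card {X \<in> P. X \<subseteq> ?d -` {b}} \<le> card {X \<in> twin_classes M r d. X \<subseteq> ?d -` {b}}"
      by (rule card_parts_within_le[OF P(1)]) simp
    also have "\<dots> \<le> card ({X \<in> twin_classes M r d. X \<subseteq> d -` {b}} \<union> {X \<in> twin_classes M r d. X \<subseteq> d -` {Suc b}})"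
    proof (intro card_mono subsetI)
      fix X assume "X \<in> {X \<in> twin_classes M r d. X \<subseteq> ?d -` {b}}"
      then have X: "X \<in> twin_classes M r d" "X \<subseteq> ?d -` {b}" by auto
      have "X \<noteq> {}" using X(1) partition_onD3[OF partition_on_classes] by blast
      then obtain x where x: "x \<in> X" by blast
      have "d x = b \<or> d x = Suc b" using x X(2) by (auto simp: contract_def split: if_splits)
      moreover have "X \<subseteq> d -` {d x}" using classes_same_block[OF X(1) _ x] by auto
      ultimately show "X \<in> {X \<in> twin_classes M r d. X \<subseteq> d -` {b}} \<union> {X \<in> twin_classes M r d. X \<subseteq> d -` {Suc b}}"
        using X(1) by auto
    qed (use fin in simp)
    also have "\<dots> \<le> card {X \<in> twin_classes M r d. X \<subseteq> d -` {b}} + card {X \<in> twin_classes M r d. X \<subseteq> d -` {Suc b}}"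
      by (rule card_Un_le)
    also have "\<dots> \<le> 2 * k" using thin[unfolded thin_def, rule_format, of b]
        thin[unfolded thin_def, rule_format, of "Suc b"] by linarith
    finally show ?thesis .
  qed
  then show "bounded_stretch M ((2 * r + 1) * (2 * k)) P"
    unfolding bounded_stretch_def using row_stretch_le[OF M mono' P(2)] by blast
qed

text \<open>Block \<open>b\<close> of the paired division contains the old blocks
  \<open>2 * b\<close> and \<open>2 * b + 1\<close>, whose union has at least \<open>k\<close> twin
  classes. Representatives of different classes differ in a far column, and far columns lie outside
  every window containing \<open>b\<close>.\<close>

lemma wide_division_if_stuck:
  assumes M: "symmetric_01_mat M" and mono: "mono_on {0..<dim_row M} d"
    and img: "d ` {0..<dim_row M} = {0..<p}" and p: "2 \<le> p"
    and stuck: "\<And>i. Suc i < p \<Longrightarrow>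
      k \<le> card {X \<in> twin_classes M (2 * k) (contract i \<circ> d). X \<subseteq> (contract i \<circ> d) -` {i}}"
  shows "\<exists>Rs Cs. wide_division k M Rs Cs"
proof -
  let ?n = "dim_row M"
  define q where "q = p div 2"
  \<comment> \<open>If p is odd, the last block joins the last pair.\<close>
  define h where "h v = min (v div 2) (q - 1)" for v
  define e where "e = h \<circ> d"
  have h: "2 * h v \<le> v" "v \<le> 2 * h v + 2" "h v < q" if "v < p" for v
    using that p by (auto simp: h_def q_def min_def)
  have h_mono: "h v \<le> h w" if "v \<le> w" for v w
    unfolding h_def using that by (intro min.mono div_le_mono order_refl)
  have "mono_on {0..<?n} e"
    using mono_onD[OF mono] by (auto intro!: mono_onI h_mono simp: e_def)
  moreover have "e ` {0..<?n} = {0..<q}"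
  proof -
    have "e ` {0..<?n} = h ` {0..<p}" unfolding e_def image_comp[symmetric] img ..
    also have "\<dots> = {0..<q}"
    proof (intro subset_antisym subsetI)
      fix b assume "b \<in> {0..<q}"
      then show "b \<in> h ` {0..<p}"
        by (intro image_eqI[of _ _ "2 * b"]) (auto simp: h_def q_def)
    qed (use h(3) in auto)
    finally show ?thesis .
  qed
  moreover have "k \<le> card (row_on M {y \<in> {0..<?n}. \<not> (j \<le> int (e y) \<and> int (e y) \<le> j + int k - 1)}
      ` {x \<in> {0..<?n}. e x = b})" (is "_ \<le> card (row_on M ?J ` ?B)")
    if b: "b < q" and j: "j \<le> int b" "int b \<le> j + int k - 1" for b j
  proof -
    let ?d = "contract (2 * b) \<circ> d"
    let ?\<X> = "{X \<in> twin_classes M (2 * k) ?d. X \<subseteq> ?d -` {2 * b}}"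
    define g where "g X = (SOME x. x \<in> X)" for X :: "nat set"
    have g: "g X \<in> X" "g X \<in> {0..<?n}" "?d (g X) = 2 * b" if "X \<in> ?\<X>" for X
    proof -
      have "X \<noteq> {}" using that partition_onD3[OF partition_on_classes] by blast
      then show gX: "g X \<in> X" unfolding g_def by (simp add: some_in_eq)
      have "X \<subseteq> {0..<?n}" using that partition_onD1[OF partition_on_classes] by blast
      then show "g X \<in> {0..<?n}" using gX by blast
      show "?d (g X) = 2 * b" using that gX by blast
    qed
    have dp: "d z < p" if "z \<in> {0..<?n}" for z
      using imageI[OF that, of d] img by simp
    \<comment> \<open>A window containing \<open>b\<close> has only pairs from
      \<open>b - k + 1\<close> to \<open>b + k - 1\<close>. The last one may consist of three
      blocks, but even then the contracted block numbers stay within \<open>2 * k\<close> of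
      \<open>2 * b\<close>.\<close>
    have far: "z \<in> ?J" if z: "z < ?n" "int (2 * k) < \<bar>int (?d z) - int (2 * b)\<bar>" for z
    proof (rule ccontr)
      assume "z \<notin> ?J"
      then have "j \<le> int (e z)" "int (e z) \<le> j + int k - 1" using z(1) by auto
      then have "int (e z) \<le> int b + int k - 1" "int b - int k + 1 \<le> int (e z)" using j by linarith+
      moreover have "2 * e z \<le> d z" "d z \<le> 2 * e z + 2" using h[OF dp, of z] z(1) by (auto simp: e_def)
      ultimately have "\<bar>int (?d z) - int (2 * b)\<bar> \<le> int (2 * k)"
        by (cases "d z \<le> 2 * b") (simp_all add: contract_def)
      then show False using z(2) by linarith
    qed
    have "k \<le> card ?\<X>" using b by (intro stuck) (auto simp: q_def)
    also have "\<dots> \<le> card (row_on M ?J ` ?B)"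
    proof (rule card_inj_on_le[where f = "\<lambda>X. row_on M ?J (g X)"])
      \<comment> \<open>\<open>?J\<close> contains all columns that \<open>twins\<close> compares,
        so equal rows on \<open>?J\<close> force the same class.\<close>
      show "inj_on (\<lambda>X. row_on M ?J (g X)) ?\<X>"
      proof (rule inj_onI)
        fix X Y assume X: "X \<in> ?\<X>" and Y: "Y \<in> ?\<X>" and eq: "row_on M ?J (g X) = row_on M ?J (g Y)"
        have "M $$ (g X, z) = M $$ (g Y, z)" if "z < ?n" "int (2 * k) < \<bar>int (?d z) - int (?d (g X))\<bar>" for z
        proof -
          have "z \<in> ?J" using far[OF that(1)] that(2) g(3)[OF X] by simp
          then show ?thesis using fun_cong[OF eq, of z] by (simp only: restrict_apply if_True)
        qed
        then have "(g X, g Y) \<in> twins M (2 * k) ?d"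
          using g(2,3)[OF X] g(2,3)[OF Y] by (simp add: twins_def)
        then show "X = Y"
          using quotient_eq_iff[OF equiv_twins _ _ g(1)[OF X] g(1)[OF Y]] X Y by blast
      qed
      show "(\<lambda>X. row_on M ?J (g X)) ` ?\<X> \<subseteq> row_on M ?J ` ?B"
      proof (rule image_subsetI, rule imageI)
        fix X assume X: "X \<in> ?\<X>"
        have "d (g X) = 2 * b \<or> d (g X) = 2 * b + 1"
          using g(3)[OF X] by (auto simp: contract_def split: if_splits)
        then have "e (g X) = b" using b by (auto simp: e_def h_def)
        then show "g X \<in> ?B" using g(2)[OF X] by simp
      qed
    qed simp
    finally show ?thesis .
  qed
  ultimately have "wide_division k M (blocks ?n e q) (blocks ?n e q)"
    by (subst wide_division_blocks_iff[OF M]) blast+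
  then show ?thesis by blast
qed

text \<open>In the division into singletons each block has exactly one row, whatever the window.
  Excluding wide divisions therefore forces \<open>2 \<le> k\<close>, which makes the singletons
  \<open>thin\<close>.\<close>

lemma exists_wide_division_le_1:
  assumes M: "symmetric_01_mat M" and "k \<le> 1"
  shows "\<exists>Rs Cs. wide_division k M Rs Cs"
proof -
  have "k \<le> card (row_on M J ` {x \<in> {0..<dim_row M}. id x = b})" if "b < dim_row M" for J b
  proof -
    have "{x \<in> {0..<dim_row M}. id x = b} = {b}" using that by auto
    then show ?thesis using assms(2) by simp
  qed
  then have "wide_division k M (blocks (dim_row M) id (dim_row M)) (blocks (dim_row M) id (dim_row M))"
    by (subst wide_division_blocks_iff[OF M]) (auto intro: mono_onI)
  then show ?thesis by blast
qed

lemma classes_id: "twin_classes M r id = singletons (dim_row M)"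
proof -
  have "twins M r id = Id_on {0..<dim_row M}" by (auto simp: twins_def)
  then show ?thesis by (auto simp: quotient_def)
qed

lemma stretch_width_le_if_no_wide_division:
  assumes M: "symmetric_01_mat M" and no_wide: "\<not> (\<exists>Rs Cs. wide_division k M Rs Cs)"
  shows "stretch_width M \<le> (4 * k + 1) * (2 * k)"
proof -
  let ?n = "dim_row M"
  define r where "r = 2 * k"
  define G where "G = bounded_stretch M ((2 * r + 1) * (2 * k))"
  have n: "1 \<le> ?n" using M by (simp add: symmetric_01_mat_def)
  have "\<not> k \<le> 1" using exists_wide_division_le_1[OF M, of k] no_wide by blast
  then have k: "2 \<le> k" by simp
  have thin_id: "card {X \<in> twin_classes M r id. X \<subseteq> id -` {b}} \<le> 1" for b
  proof -
    have "{X \<in> twin_classes M r id. X \<subseteq> id -` {b}} \<subseteq> {{b}}" by (auto simp: classes_id)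
    then have "card {X \<in> twin_classes M r id. X \<subseteq> id -` {b}} \<le> card {{b}}" by (intro card_mono) auto
    then show ?thesis by simp
  qed
  \<comment> \<open>\<open>merge_step\<close> tests \<open>G\<close> only on its result, so the
    initial partition needs its own bound.\<close>
  have G_singletons: "G (singletons ?n)"
    unfolding G_def bounded_stretch_def
  proof
    fix X assume X: "X \<in> singletons ?n"
    have "row_stretch M (singletons ?n, singletons ?n) X \<le> (2 * r + 1) * (2 * k)"
    proof (rule row_stretch_le[OF M _ _ _ X, where d = id])
      show "mono_on {0..<?n} id" by (auto intro: mono_onI)
      show "refines {0..<?n} (singletons ?n) (twin_classes M r id)"
        using refines_refl[OF partition_on_classes, of M r id] by (simp add: classes_id)
      show "card {X \<in> singletons ?n. X \<subseteq> id -` {b}} \<le> 2 * k" for b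
        using thin_id[of b] k by (simp add: classes_id)
    qed
    then show "row_stretch M (singletons ?n, singletons ?n) X \<le> (2 * r + 1) * (2 * k)" .
  qed
  \<comment> \<open>The \<open>1\<close> in \<open>{0..<1}\<close> is the number of blocks: the
    induction goes down from \<open>?n\<close> singleton blocks, losing one block at each
    contraction.\<close>
  have "\<exists>d. mono_on {0..<?n} d \<and> d ` {0..<?n} = {0..<1} \<and> thin M r k d \<and>
      (merge_step G)\<^sup>*\<^sup>* (singletons ?n) (twin_classes M r d)"
    using n
  proof (induction rule: inc_induct)
    case base
    have "card {X \<in> twin_classes M r id. X \<subseteq> id -` {b}} < k" for b
      using thin_id[of b] k by linarith
    then have "thin M r k id" unfolding thin_def by blast
    moreover have "mono_on {0..<?n} id" by (auto intro: mono_onI)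
    moreover have "(merge_step G)\<^sup>*\<^sup>* (singletons ?n) (twin_classes M r id)"
      unfolding classes_id by (rule rtranclp.rtrancl_refl)
    moreover have "id ` {0..<?n} = {0..<?n}" by simp
    ultimately show ?case by blast
  next
    case (step q)
    then obtain d where d: "mono_on {0..<?n} d" "d ` {0..<?n} = {0..<Suc q}" "thin M r k d"
      "(merge_step G)\<^sup>*\<^sup>* (singletons ?n) (twin_classes M r d)" by blast
    have "2 \<le> Suc q" using step.hyps by simp
    then obtain i where i: "Suc i < Suc q"
      "card {X \<in> twin_classes M r (contract i \<circ> d). X \<subseteq> (contract i \<circ> d) -` {i}} < k"
      using wide_division_if_stuck[OF M d(1,2)] no_wide unfolding r_def by (meson not_le)
    let ?d = "contract i \<circ> d"
    have "mono_on {0..<?n} ?d"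
      using mono_onD[OF d(1)] by (auto intro!: mono_onI contract_mono)
    moreover have "?d ` {0..<?n} = {0..<q}"
      using contract_image[of i q] i(1) unfolding image_comp[symmetric] d(2) by simp
    moreover have "thin M r k ?d" by (rule thin_contract[OF d(3) i(2)])
    moreover have "(merge_step G)\<^sup>*\<^sup>* (singletons ?n) (twin_classes M r ?d)"
      using d(4) merge_steps_contract[OF M d(1,3), of i] unfolding G_def by (rule rtranclp_trans)
    ultimately show ?case by blast
  qed
  then obtain d where img: "d ` {0..<?n} = {0..<1}"
    and steps: "(merge_step G)\<^sup>*\<^sup>* (singletons ?n) (twin_classes M r d)" by blast
  have d0: "d x = 0" if "x < ?n" for x using imageI[of x "{0..<?n}" d] img that by simp
  \<comment> \<open>With a single block all distances are \<open>0\<close>, so no column is compared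
    and all indices are twins.\<close>
  have "twins M r d = {0..<?n} \<times> {0..<?n}" by (auto simp: twins_def d0)
  then have "twin_classes M r d = {{0..<?n}}" 
    using n by (auto simp: quotient_def intro!: bexI[of _ 0])
  then have "(merge_step G)\<^sup>*\<^sup>* (singletons ?n) {{0..<?n}}" using steps by simp
  from exists_symmetric_partition_sequence[OF M this G_singletons]
  obtain P where P: "symmetric_partition_sequence M P"
    "\<And>t. t \<in> {1..?n} \<Longrightarrow> \<exists>Q. P t = (Q, Q) \<and> partition_on {0..<?n} Q \<and> G Q" by blast
  have "stretch_value M (P t) \<le> (2 * r + 1) * (2 * k)" if t: "t \<in> {1..?n}" for t
  proof -
    obtain Q where Q: "P t = (Q, Q)" "partition_on {0..<?n} Q" "G Q" using P(2)[OF t] by blast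
    then show ?thesis
      using stretch_value_le_iff[OF M Q(2)] by (simp add: G_def bounded_stretch_def)
  qed
  from stretch_width_le[OF M P(1) this] show ?thesis by (simp add: r_def mult.assoc[symmetric])
qed

theorem theorem3:
  fixes \<M> :: "int mat set"
  assumes "\<forall>M\<in>\<M>. symmetric_01_mat M"
  shows "(\<exists>c. \<forall>M\<in>\<M>. stretch_width M \<le> c) \<longleftrightarrow>
         (\<exists>k. \<forall>M\<in>\<M>. \<not> (\<exists>Rs Cs. wide_division k M Rs Cs))"
proof
  assume "\<exists>c. \<forall>M\<in>\<M>. stretch_width M \<le> c"
  then obtain c where c: "\<And>M. M \<in> \<M> \<Longrightarrow> stretch_width M \<le> c" by blast
  have "\<not> wide_division (8 * c + 2) M Rs Cs" if "M \<in> \<M>" for M Rs Cs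
  proof -
    have M: "symmetric_01_mat M" using assms that by blast
    from stretch_width_attained[OF M] obtain P where P: "symmetric_partition_sequence M P"
      "\<And>t. t \<in> {1..dim_row M} \<Longrightarrow> stretch_value M (P t) \<le> stretch_width M" by blast
    show ?thesis by (rule no_wide_division[OF M P(1)]) (use P(2) c[OF that] in \<open>meson order_trans\<close>)
  qed
  then show "\<exists>k. \<forall>M\<in>\<M>. \<not> (\<exists>Rs Cs. wide_division k M Rs Cs)" by blast
next
  assume "\<exists>k. \<forall>M\<in>\<M>. \<not> (\<exists>Rs Cs. wide_division k M Rs Cs)"
  then obtain k where "\<And>M. M \<in> \<M> \<Longrightarrow> \<not> (\<exists>Rs Cs. wide_division k M Rs Cs)" by blast
  then show "\<exists>c. \<forall>M\<in>\<M>. stretch_width M \<le> c"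
    using stretch_width_le_if_no_wide_division assms by blast
qed

end
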